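(* Let $g\geqslant2$ and let $X$ be a stable irreducible rational nodal curve with nodes at $p_1,\dots,p_g$. Let $L$ be an invertible sheaf of positive degree on $X$ which extends to an invertible sheaf on each curve represented by a point in a neighborhood of $[X]$ in $\overline{\mathcal M}_g$, and let $\mu_X=\lim_{m\to\infty}\mu^W_{mL}$. Then $$\mu_X=\frac1g\sum_{i=1}^g\delta_{p_i}.$$
   Context: $\overline{\mathcal M}_g$ is the Deligne–Mumford compactification of the moduli space of compact Riemann surfaces of genus $g$. A rational nodal curve is an irreducible nodal curve whose normalization is $\mathbb P^1_{\mathbb C}$. $\delta_p$ is the Dirac delta at $p$. Weierstrass points: let $C$ be a stable curve with dualizing sheaf $\omega_C$, $L$ a line bundle on $C$, $n=h^0(C,L)$, and $\phi_1,\dots,\phi_n$ a basis of $H^0(C,L)$. On a small open set $U$ let $\psi,\tau_U$ be generators of $L$ and $\omega_C$. Define functions $F_{i,j}$ on $U$ by $F_{1,j}\psi=\phi_j|_U$ and $F_{i,j}\tau_U=dF_{i-1,j}$ for $2\leqslant i\leqslant n$, $1\leqslant j\leqslant n$. Then $\rho=\det(F_{i,j})\,\psi^n\tau_U^{(n-1)n/2}$ defines a global section $\rho\in H^0(C,L^n\otimes\omega_C^{(n-1)n/2})$, the Wronskian. A point $p\in C$ is a Weierstrass point of $L$ if $\operatorname{ord}_p\rho>0$, and its weight is $w_L(p)=\operatorname{ord}_p\rho$, where, writing $\rho=f\cdot(\text{local generator})$ near $p$, $\operatorname{ord}_p\rho=\dim_{\mathbb C}\mathcal O_{C,p}/(f)$.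 Let $W(L)$ be the set of Weierstrass points. The Weierstrass measure is the probability measure $$\mu^W_{L}=\mu^W_{C,L}=\frac{\sum_{p\in W(L)}w_L(p)\,\delta_p}{\sum_{p\in W(L)}w_L(p)}.$$ $mL$ denotes $L^{\otimes m}$. Limits of measures on $X$ are weak limits (against continuous functions on $X$). *)

theory Defs
  imports
    "HOL-Analysis.Analysis"
    "HOL-Computational_Algebra.Computational_Algebra"
    "HOL-Computational_Algebra.Field_as_Ring"
    "Jordan_Normal_Form.Determinant"
begin

section \<open>The projective line and its function field\<close>

text \<open>
  Points of the complex projective line are \<open>Some a\<close> (with local parameter \<open>t - a\<close>) and
  \<open>None\<close>, the point at infinity (with local parameter \<open>1 / t\<close>).  The function field is
  \<open>\<complex>(t)\<close>.
\<close>

type_synonym p1 = "complex option"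
type_synonym ratfun = "complex poly fract"

definition p1_topology :: "p1 topology" where
  "p1_topology = Alexandroff_compactification euclidean"

definition const_fun :: "complex \<Rightarrow> ratfun" where
  "const_fun c = to_fract [:c:]"

definition cscale :: "complex \<Rightarrow> ratfun \<Rightarrow> ratfun" where
  "cscale c f = const_fun c * f"

lemma const_fun_hom:
  "const_fun (a + b) = const_fun a + const_fun b"
  "const_fun (a * b) = const_fun a * const_fun b"
  "const_fun 1 = 1"
  by (simp_all add: const_fun_def to_fract_def one_pCons One_fract_def mult.commute)

global_interpretation ratfun: vector_space cscale
  by standard (simp_all add: cscale_def const_fun_hom algebra_simps)

text \<open>The derivation \<open>d/dt\<close>.\<close>

definition fract_deriv :: "ratfun \<Rightarrow> ratfun" where
  "fract_deriv f = (let (p, r) = quot_of_fract f in Fract (pderiv p * r - p * pderiv r) (r * r))"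

text \<open>
  The Laurent expansion at \<open>q\<close> in the local parameter \<open>s\<close> is obtained by substituting
  \<open>t = a + s\<close>, respectively \<open>t = 1 / s\<close>, in numerator and denominator.
\<close>

definition coordinate_at :: "p1 \<Rightarrow> complex fls" where
  "coordinate_at q = (case q of Some a \<Rightarrow> fls_const a + fls_X | None \<Rightarrow> fls_X_inv)"

definition expansion :: "p1 \<Rightarrow> ratfun \<Rightarrow> complex fls" where
  "expansion q f = (let (p, r) = quot_of_fract f in
     poly (map_poly fls_const p) (coordinate_at q) / poly (map_poly fls_const r) (coordinate_at q))"

text \<open>Note that \<open>fls_subdegree 0 = 0\<close>, so the local ring contains \<open>0\<close>.\<close>

definition p1_local_ring :: "p1 \<Rightarrow> ratfun set" where
  "p1_local_ring q = {f. 0 \<le> fls_subdegree (expansion q f)}"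

definition value_at :: "p1 \<Rightarrow> ratfun \<Rightarrow> complex" where
  "value_at q f = fls_nth (expansion q f) 0"

text \<open>
  Rational differentials are written \<open>h dt\<close> and represented by \<open>h\<close>.  The residue is the
  coefficient of \<open>ds / s\<close>, where \<open>dt = (dt/ds) ds\<close>.
\<close>

definition diff_residue :: "p1 \<Rightarrow> ratfun \<Rightarrow> complex" where
  "diff_residue q h = fls_nth (expansion q h * fls_deriv (coordinate_at q)) (-1)"


section \<open>Rational nodal curves\<close>

text \<open>
  An integral projective curve with normalization \<open>\<nu>\<close> from the projective line is given by
  \<open>\<nu>\<close>, viewed as a map onto its set of closed points, and by its local rings, which are
  subrings of the common function field \<open>\<complex>(t)\<close>.
\<close>

record 'x curve =
  normalization :: "p1 \<Rightarrow> 'x"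
  stalk :: "'x \<Rightarrow> ratfun set"

definition points :: "('x, 'z) curve_scheme \<Rightarrow> 'x set" where
  "points X = range (normalization X)"

definition smooth_point :: "('x, 'z) curve_scheme \<Rightarrow> 'x \<Rightarrow> bool" where
  "smooth_point X x \<longleftrightarrow>
     (\<exists>q. normalization X -` {x} = {q} \<and> stalk X x = p1_local_ring q)"

text \<open>
  A node is an ordinary double point: two points \<open>a\<close>, \<open>b\<close> of the normalization lie over it, and a
  function on the normalization descends iff it takes the same value at \<open>a\<close> and \<open>b\<close>.  The
  completion of this local ring is \<open>{(u, v) \<in> \<complex>[[s]] \<times> \<complex>[[s']]. u(0) = v(0)}\<close>, that is,
  \<open>\<complex>[[s, s']] / (s s')\<close>.
\<close>

definition node :: "('x, 'z) curve_scheme \<Rightarrow> 'x \<Rightarrow> bool" where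
  "node X x \<longleftrightarrow>
     (\<exists>a b. a \<noteq> b \<and> normalization X -` {x} = {a, b} \<and>
        stalk X x = {f \<in> p1_local_ring a \<inter> p1_local_ring b. value_at a f = value_at b f})"

definition rational_nodal_curve :: "('x, 'z) curve_scheme \<Rightarrow> bool" where
  "rational_nodal_curve X \<longleftrightarrow>
     finite {x. node X x} \<and> (\<forall>x \<in> points X. smooth_point X x \<or> node X x)"

text \<open>
  Automorphisms of the curve are the \<open>\<complex>\<close>-automorphisms of its function field which permute the
  local rings.
\<close>

definition curve_automorphisms :: "('x, 'z) curve_scheme \<Rightarrow> (ratfun \<Rightarrow> ratfun) set" where
  "curve_automorphisms X =
     {\<sigma>. bij \<sigma> \<and> (\<forall>f g. \<sigma> (f + g) = \<sigma> f + \<sigma> g \<and> \<sigma> (f * g) = \<sigma> f * \<sigma> g) \<and>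
         (\<forall>c. \<sigma> (const_fun c) = const_fun c) \<and>
         (\<exists>s. bij_betw s (points X) (points X) \<and> (\<forall>x \<in> points X. \<sigma> ` stalk X x = stalk X (s x)))}"

definition stable_rational_nodal_curve :: "('x, 'z) curve_scheme \<Rightarrow> bool" where
  "stable_rational_nodal_curve X \<longleftrightarrow> rational_nodal_curve X \<and> finite (curve_automorphisms X)"

text \<open>The complex topology of the curve is the quotient topology of the Riemann sphere.\<close>

definition curve_topology :: "('x, 'z) curve_scheme \<Rightarrow> 'x topology" where
  "curve_topology X =
     topology (\<lambda>U. U \<subseteq> points X \<and> openin p1_topology (normalization X -` U))"

lemma openin_curve_topology:
  "openin (curve_topology X) U \<longleftrightarrow>
     U \<subseteq> points X \<and> openin p1_topology (normalization X -` U)"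
proof -
  have "istopology (\<lambda>U. U \<subseteq> points X \<and> openin p1_topology (normalization X -` U))"
    by (auto simp: istopology_def vimage_Union)
  then show ?thesis
    by (simp add: curve_topology_def)
qed


section \<open>Invertible sheaves\<close>

text \<open>Dimension of a quotient \<open>A / B\<close> of complex subspaces, as the size of a basis.\<close>

definition quotient_basis :: "ratfun set \<Rightarrow> ratfun set \<Rightarrow> ratfun set \<Rightarrow> bool" where
  "quotient_basis A B S \<longleftrightarrow>
     finite S \<and> S \<subseteq> A \<and>
     (\<forall>f \<in> A. \<exists>!c. (\<forall>s. s \<notin> S \<longrightarrow> c s = 0) \<and> f - (\<Sum>s\<in>S. cscale (c s) s) \<in> B)"

definition quotient_dim :: "ratfun set \<Rightarrow> ratfun set \<Rightarrow> nat" where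
  "quotient_dim A B = (THE n. \<exists>S. quotient_basis A B S \<and> card S = n)"

definition ord_at :: "('x, 'z) curve_scheme \<Rightarrow> 'x \<Rightarrow> ratfun \<Rightarrow> nat" where
  "ord_at X x f = quotient_dim (stalk X x) ((*) f ` stalk X x)"

text \<open>
  On an integral curve every invertible sheaf is isomorphic to a subsheaf of the constant sheaf of
  rational functions.  Such a subsheaf is given by its stalks.  Nonempty Zariski-open subsets are
  the cofinite ones, so the condition below says that it is locally generated by one nonzero
  rational function.
\<close>

definition generates :: "('x, 'z) curve_scheme \<Rightarrow> ('x \<Rightarrow> ratfun set) \<Rightarrow> 'x \<Rightarrow> ratfun \<Rightarrow> bool" where
  "generates X F x \<psi> \<longleftrightarrow> \<psi> \<noteq> 0 \<and> F x = (*) \<psi> ` stalk X x"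

definition invertible_sheaf :: "('x, 'z) curve_scheme \<Rightarrow> ('x \<Rightarrow> ratfun set) \<Rightarrow> bool" where
  "invertible_sheaf X L \<longleftrightarrow>
     (\<forall>x \<in> points X. \<exists>\<psi>. generates X L x \<psi> \<and> finite {y \<in> points X. \<not> generates X L y \<psi>})"

definition global_sections :: "('x, 'z) curve_scheme \<Rightarrow> ('x \<Rightarrow> ratfun set) \<Rightarrow> ratfun set" where
  "global_sections X L = {f. \<forall>x \<in> points X. f \<in> L x}"

text \<open>
  If \<open>L\<close> is locally generated by \<open>b / a\<close>, then \<open>L = \<O>(D)\<close> for the Cartier divisor \<open>D\<close> with local
  equation \<open>a / b\<close>, whose order at the point is \<open>ord a - ord b\<close>.
\<close>

definition local_degree :: "('x, 'z) curve_scheme \<Rightarrow> ('x \<Rightarrow> ratfun set) \<Rightarrow> 'x \<Rightarrow> int" where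
  "local_degree X L x =
     (THE d. \<exists>a b. a \<in> stalk X x \<and> b \<in> stalk X x \<and> a \<noteq> 0 \<and> b \<noteq> 0 \<and> generates X L x (b / a) \<and>
               d = int (ord_at X x a) - int (ord_at X x b))"

definition sheaf_degree :: "('x, 'z) curve_scheme \<Rightarrow> ('x \<Rightarrow> ratfun set) \<Rightarrow> int" where
  "sheaf_degree X L = (\<Sum>x | x \<in> points X \<and> L x \<noteq> stalk X x. local_degree X L x)"

definition module_product :: "ratfun set \<Rightarrow> ratfun set \<Rightarrow> ratfun set" where
  "module_product A B =
     {f. \<exists>(k::nat) a b. (\<forall>i<k. a i \<in> A \<and> b i \<in> B) \<and> f = (\<Sum>i<k. a i * b i)}"

text \<open>
  For invertible subsheaves of the sheaf of rational functions the tensor product is the product.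
\<close>

primrec tensor_power :: "('x, 'z) curve_scheme \<Rightarrow> nat \<Rightarrow> ('x \<Rightarrow> ratfun set) \<Rightarrow> 'x \<Rightarrow> ratfun set"
  where
    "tensor_power X 0 L = stalk X"
  | "tensor_power X (Suc m) L = (\<lambda>x. module_product (L x) (tensor_power X m L x))"

text \<open>
  The dualizing sheaf consists of Rosenlicht's regular differentials: \<open>h dt\<close> is regular at \<open>x\<close>
  iff the sum of the residues of \<open>f h dt\<close> over the points above \<open>x\<close> vanishes for all functions
  \<open>f\<close> regular at \<open>x\<close>.
\<close>

definition dualizing_sheaf :: "('x, 'z) curve_scheme \<Rightarrow> 'x \<Rightarrow> ratfun set" where
  "dualizing_sheaf X x =
     {h. \<forall>f \<in> stalk X x. (\<Sum>q \<in> normalization X -` {x}. diff_residue q (f * h)) = 0}"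


section \<open>Weierstrass points\<close>

definition h0 :: "('x, 'z) curve_scheme \<Rightarrow> ('x \<Rightarrow> ratfun set) \<Rightarrow> nat" where
  "h0 X L = ratfun.dim (global_sections X L)"

definition section_basis ::
    "('x, 'z) curve_scheme \<Rightarrow> ('x \<Rightarrow> ratfun set) \<Rightarrow> (nat \<Rightarrow> ratfun) \<Rightarrow> bool" where
  "section_basis X L \<phi> \<longleftrightarrow>
     inj_on \<phi> {..<h0 X L} \<and> ratfun.independent (\<phi> ` {..<h0 X L}) \<and>
     ratfun.span (\<phi> ` {..<h0 X L}) = global_sections X L"

text \<open>
  Row \<open>i\<close> of the Wronskian matrix, with rows counted from \<open>0\<close>; \<open>\<phi>\<close> is a section, \<open>\<psi>\<close> a local
  generator of the invertible sheaf, and \<open>\<tau> dt\<close> one of the dualizing sheaf, so that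
  \<open>F\<^sub>i\<^sub>+\<^sub>1 \<tau> dt = dF\<^sub>i\<close>.
\<close>

primrec wronskian_entry :: "ratfun \<Rightarrow> ratfun \<Rightarrow> nat \<Rightarrow> ratfun \<Rightarrow> ratfun" where
  "wronskian_entry \<psi> \<tau> 0 \<phi> = \<phi> / \<psi>"
| "wronskian_entry \<psi> \<tau> (Suc i) \<phi> = fract_deriv (wronskian_entry \<psi> \<tau> i \<phi>) / \<tau>"

text \<open>
  The coefficient of the Wronskian with respect to a local generator at \<open>x\<close> of
  \<open>L\<^sup>n \<otimes> \<omega>\<^sup>n\<^sup>(\<^sup>n\<^sup>-\<^sup>1\<^sup>)\<^sup>/\<^sup>2\<close>; it depends on choices only up to units of the local ring.
\<close>

definition wronskian_germ ::
    "('x, 'z) curve_scheme \<Rightarrow> ('x \<Rightarrow> ratfun set) \<Rightarrow> 'x \<Rightarrow> ratfun \<Rightarrow> bool" where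
  "wronskian_germ X L x f \<longleftrightarrow>
     (\<exists>\<phi> \<psi> \<tau>. section_basis X L \<phi> \<and> generates X L x \<psi> \<and> generates X (dualizing_sheaf X) x \<tau> \<and>
        f = Determinant.det
              (mat (h0 X L) (h0 X L) (\<lambda>(i, j). wronskian_entry \<psi> \<tau> i (\<phi> j))))"

definition weierstrass_weight ::
    "('x, 'z) curve_scheme \<Rightarrow> ('x \<Rightarrow> ratfun set) \<Rightarrow> 'x \<Rightarrow> nat" where
  "weierstrass_weight X L x = (THE w. \<exists>f. wronskian_germ X L x f \<and> w = ord_at X x f)"

definition weierstrass_points :: "('x, 'z) curve_scheme \<Rightarrow> ('x \<Rightarrow> ratfun set) \<Rightarrow> 'x set" where
  "weierstrass_points X L = {x \<in> points X. 0 < weierstrass_weight X L x}"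


section \<open>Measures\<close>

text \<open>The Borel measure \<open>\<Sum>i\<in>I. c i * \<delta>\<^bsub>p i\<^esub>\<close> on a topological space.\<close>

definition dirac_sum :: "'x topology \<Rightarrow> 'i set \<Rightarrow> ('i \<Rightarrow> real) \<Rightarrow> ('i \<Rightarrow> 'x) \<Rightarrow> 'x measure" where
  "dirac_sum T I c p =
     measure_of (topspace T) {U. openin T U} (\<lambda>A. \<Sum>i\<in>I. ennreal (c i) * indicator A (p i))"

definition weierstrass_measure ::
    "('x, 'z) curve_scheme \<Rightarrow> ('x \<Rightarrow> ratfun set) \<Rightarrow> 'x measure" where
  "weierstrass_measure X L =
     dirac_sum (curve_topology X) (weierstrass_points X L)
       (\<lambda>x. real (weierstrass_weight X L x) /
            (\<Sum>y \<in> weierstrass_points X L. real (weierstrass_weight X L y)))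
       (\<lambda>x. x)"

definition weak_limit :: "'x topology \<Rightarrow> (nat \<Rightarrow> 'x measure) \<Rightarrow> 'x measure \<Rightarrow> bool" where
  "weak_limit T M N \<longleftrightarrow>
     (\<forall>f. continuous_map T euclideanreal f \<longrightarrow>
        (\<lambda>m. integral\<^sup>L (M m) f) \<longlonglongrightarrow> integral\<^sup>L N f)"

end

theory Submission
  imports Defs "HOL-Real_Asymp.Real_Asymp"
begin

text \<open>
  Pull everything back to the normalization.  For a basis \<open>\<phi>\<^sub>1, \<dots>, \<phi>\<^sub>n\<close> of the sections of \<open>mL\<close> let
  \<open>W = det (d\<^sup>i\<phi>\<^sub>j/dt\<^sup>i)\<close> be the classical Wronskian.  Passing to local generators \<open>\<psi>\<close> and \<open>\<tau> dt\<close> is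
  a triangular change of rows, so the Wronskian germ has order
  \<open>ord W - n ord \<psi> - n (n - 1) / 2 ord \<tau>\<close> at every point \<open>q\<close> of the projective line.  At a smooth
  point \<open>\<tau> dt\<close> generates the differentials of the projective line; over a node it has a simple pole.
  Hence the order is \<open>\<epsilon>(q) \<ge> 0\<close>, plus \<open>n (n - 1) / 2\<close> if \<open>q\<close> lies over a node, and the order at a
  point of the curve is the sum over its preimages.  As the divisor of \<open>W\<close> has degree \<open>0\<close>, the
  \<open>\<epsilon>(q)\<close> add up to \<open>n (deg mL - n + 1)\<close>.  Functions that vanish at all preimages of the nodes
  descend to the curve, so \<open>n \<ge> deg mL + 1 - 2 g\<close> and this sum is at most \<open>2 g n\<close>.  It is negligible
  against the weight \<open>n (n - 1)\<close> that every node carries.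
\<close>


section \<open>Laurent expansions and orders of rational functions\<close>

text \<open>A generator of the dualizing sheaf at a node must have opposite nonzero residues on the
  two branches. Hence it has a simple pole on each, and every division by \<open>\<tau>\<close> in
  the Wronskian matrix adds a zero: row \<open>i\<close>, counted from 0, is divided
  \<open>i\<close> times, which accounts for n (n - 1) / 2 on each branch.

  The obstacle is the gluing condition. The local ring of a node is not described by orders, yet
  weights, degrees and sections have to be computed from orders on the projective line. The way out
  is the conductor: a function vanishing on both branches has equal values there, so it lies in the
  local ring. Common denominators of generators, test functions for residues and the Wronskian germ
  itself are all placed in it. For sections it gives a lower space whose dimension falls short of
  the upper one by the 2 g branches over the nodes; the constant 2 g is this gap.

  A second concern is that weights, degrees and quotient dimensions are definite descriptions, so
  independence of bases, generators and representatives has to be proved each time.\<close>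

definition poly_at :: "p1 \<Rightarrow> complex poly \<Rightarrow> complex fls" where
  "poly_at q p = poly (map_poly fls_const p) (coordinate_at q)"

lemma poly_at_0 [simp]: "poly_at q 0 = 0"
  by (simp add: poly_at_def)

lemma poly_at_pCons [simp]:
  "poly_at q (pCons c p) = fls_const c + coordinate_at q * poly_at q p"
  by (simp add: poly_at_def map_poly_pCons)

lemma poly_at_1 [simp]: "poly_at q 1 = 1"
  by (simp add: one_pCons)

lemma poly_at_add: "poly_at q (p + r) = poly_at q p + poly_at q r"
  by (induction p r rule: poly_induct2) (simp_all add: algebra_simps fls_plus_const)

lemma poly_at_smult: "poly_at q (Polynomial.smult c p) = fls_const c * poly_at q p"
  by (induction p) (simp_all add: algebra_simps)

lemma poly_at_mult: "poly_at q (p * r) = poly_at q p * poly_at q r"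
  by (induction p) (simp_all add: algebra_simps poly_at_add poly_at_smult)

lemma poly_at_diff: "poly_at q (p - r) = poly_at q p - poly_at q r"
  using poly_at_add[of q "p - r" r] by simp

lemma poly_at_power: "poly_at q (p ^ n) = poly_at q p ^ n"
  by (induction n) (simp_all add: poly_at_mult)

text \<open>The factor 1 / s gained in each induction step moves the lowest term of the nonconstant
  part to a negative exponent, where the added constant cannot cancel it.\<close>

lemma poly_at_None:
  assumes "p \<noteq> 0"
  shows "poly_at None p \<noteq> 0 \<and> fls_subdegree (poly_at None p) = - int (degree p)"
  using assms
proof (induction p)
  case (pCons c p)
  show ?case
  proof (cases "p = 0")
    case True
    with pCons show ?thesis by simp
  next
    case False
    define P where "P = coordinate_at None * poly_at None p"
    have P: "P \<noteq> 0" "fls_subdegree P = - 1 - int (degree p)"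
      using pCons.IH False by (auto simp: P_def coordinate_at_def)
    have "fls_nth (fls_const c + P) (- 1 - int (degree p)) = fls_nth P (- 1 - int (degree p))"
      by simp
    also have "\<dots> \<noteq> 0"
      using P nth_fls_subdegree_nonzero[of P] by simp
    finally have nz: "fls_nth (fls_const c + P) (- 1 - int (degree p)) \<noteq> 0" .
    moreover have "fls_subdegree (fls_const c + P) = - 1 - int (degree p)"
      using nz by (rule fls_subdegree_eqI) (use P in auto)
    moreover from nz have "fls_const c + P \<noteq> 0"
      by (metis fls_zero_nth)
    ultimately show ?thesis
      using False by (simp add: P_def)
  qed
qed simp

lemma poly_at_Some_fps: "\<exists>F. poly_at (Some a) p = fps_to_fls F \<and> fps_nth F 0 = poly p a"
proof (induction p)
  case 0
  show ?case by (rule exI[of _ 0]) simp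
next
  case (pCons c p)
  then obtain F where "poly_at (Some a) p = fps_to_fls F" "fps_nth F 0 = poly p a"
    by blast
  then show ?case
    by (intro exI[of _ "fps_const c + (fps_const a + fps_X) * F"])
      (simp add: coordinate_at_def fls_times_fps_to_fls)
qed

text \<open>Splitting off the maximal power of t - a leaves a cofactor whose expansion is a power
  series with nonzero constant term, hence a unit.\<close>

lemma poly_at_Some:
  assumes "p \<noteq> 0"
  shows "poly_at (Some a) p \<noteq> 0 \<and> fls_subdegree (poly_at (Some a) p) = int (order a p)"
proof -
  obtain r where r: "p = [:-a, 1:] ^ order a p * r" "\<not> [:-a, 1:] dvd r"
    using order_decomp[OF assms] by blast
  obtain F where F: "poly_at (Some a) r = fps_to_fls F" "fps_nth F 0 = poly r a"
    using poly_at_Some_fps by blast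
  have F0: "fps_nth F 0 \<noteq> 0"
    using r(2) F(2) by (simp add: poly_eq_0_iff_dvd)
  have 1: "poly_at (Some a) r \<noteq> 0" "fls_subdegree (poly_at (Some a) r) = 0"
    unfolding F by (use F0 in \<open>auto simp: fls_subdegree_fls_to_fps\<close>)
  have 2: "poly_at (Some a) p = fls_X ^ order a p * poly_at (Some a) r"
    by (subst r(1)) (simp add: poly_at_mult poly_at_power coordinate_at_def)
  show ?thesis
    unfolding 2 using 1 by simp
qed

lemma poly_at_eq_0_iff [simp]: "poly_at q p = 0 \<longleftrightarrow> p = 0"
  by (cases q) (use poly_at_None poly_at_Some in auto)

lemma ratfun_cases:
  obtains p r where "r \<noteq> 0" "f = (Fract p r :: ratfun)"
  by (cases f) auto

text \<open>\<open>expansion\<close> is defined through the reduced fraction chosen by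
  \<open>quot_of_fract\<close>. Cross multiplication, transported by the injective ring homomorphism
  \<open>poly_at q\<close>, frees it from that choice; the field operations below depend on
  this.\<close>

lemma expansion_Fract:
  assumes "r \<noteq> 0"
  shows "expansion q (Fract p r) = poly_at q p / poly_at q r"
proof -
  obtain a b where ab: "quot_of_fract (Fract p r) = (a, b)"
    by fastforce
  have "b \<noteq> 0" "Fract a b = Fract p r"
    using snd_quot_of_fract_nonzero[of "Fract p r"] Fract_quot_of_fract[of "Fract p r"]
    by (simp_all add: ab)
  then have "a * r = p * b"
    using assms by (simp add: eq_fract)
  then have "poly_at q a * poly_at q r = poly_at q p * poly_at q b"
    by (metis poly_at_mult)
  then show ?thesis
    using assms \<open>b \<noteq> 0\<close>
    by (simp add: expansion_def ab frac_eq_eq flip: poly_at_def)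
qed

lemma expansion_to_fract: "expansion q (to_fract p) = poly_at q p"
  by (simp add: to_fract_def expansion_Fract)

lemma expansion_add: "expansion q (f + g) = expansion q f + expansion q g"
proof -
  obtain a b c d where "b \<noteq> 0" "f = Fract a b" "d \<noteq> 0" "g = Fract c d"
    by (metis ratfun_cases)
  then show ?thesis
    by (simp add: expansion_Fract poly_at_add poly_at_mult add_frac_eq)
qed

lemma expansion_mult: "expansion q (f * g) = expansion q f * expansion q g"
proof -
  obtain a b c d where "b \<noteq> 0" "f = Fract a b" "d \<noteq> 0" "g = Fract c d"
    by (metis ratfun_cases)
  then show ?thesis
    by (simp add: expansion_Fract poly_at_mult)
qed

lemma expansion_const [simp]: "expansion q (const_fun c) = fls_const c"
  by (simp add: const_fun_def expansion_to_fract)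

lemma const_fun_0 [simp]: "const_fun 0 = 0"
  by (simp add: const_fun_def)

lemma const_fun_1 [simp]: "const_fun 1 = 1"
  by (simp add: const_fun_hom)

lemma expansion_0 [simp]: "expansion q 0 = 0"
  using expansion_const[of q 0] by simp

lemma expansion_1 [simp]: "expansion q 1 = 1"
  using expansion_const[of q 1] by simp

lemma expansion_cscale: "expansion q (cscale c f) = fls_const c * expansion q f"
  by (simp add: cscale_def expansion_mult)

lemma expansion_eq_0_iff [simp]: "expansion q f = 0 \<longleftrightarrow> f = 0"
proof -
  obtain a b where "b \<noteq> 0" "f = Fract a b"
    by (metis ratfun_cases)
  then show ?thesis
    by (simp add: expansion_Fract eq_fract Zero_fract_def)
qed

lemma expansion_uminus: "expansion q (- f) = - expansion q f"
  using expansion_add[of q f "- f"] by (simp add: eq_neg_iff_add_eq_0 add.commute)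

lemma expansion_diff: "expansion q (f - g) = expansion q f - expansion q g"
  using expansion_add[of q f "- g"] by (simp add: expansion_uminus)

lemma expansion_eq_iff: "expansion q f = expansion q g \<longleftrightarrow> f = g"
  using expansion_diff[of q f g] expansion_eq_0_iff[of q "f - g"] by simp

lemma expansion_inverse: "expansion q (inverse f) = inverse (expansion q f)"
proof (cases "f = 0")
  case False
  then have "expansion q f * expansion q (inverse f) = 1"
    by (simp flip: expansion_mult)
  then show ?thesis
    by (metis inverse_unique)
qed simp

section \<open>Orders of vanishing and the filtration they define\<close>

abbreviation coeff_at :: "p1 \<Rightarrow> int \<Rightarrow> ratfun \<Rightarrow> complex" where
  "coeff_at q n f \<equiv> fls_nth (expansion q f) n"

definition ord :: "p1 \<Rightarrow> ratfun \<Rightarrow> int" where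
  "ord q f = fls_subdegree (expansion q f)"

lemma ord_0 [simp]: "ord q 0 = 0" and ord_1 [simp]: "ord q 1 = 0"
  by (simp_all add: ord_def)

lemma ord_const [simp]: "ord q (const_fun c) = 0"
  by (simp add: ord_def)

lemma ord_mult: "f \<noteq> 0 \<Longrightarrow> g \<noteq> 0 \<Longrightarrow> ord q (f * g) = ord q f + ord q g"
  by (simp add: ord_def expansion_mult)

lemma ord_inverse [simp]: "ord q (inverse f) = - ord q f"
  by (cases "f = 0") (simp_all add: ord_def expansion_inverse)

lemma ord_divide: "f \<noteq> 0 \<Longrightarrow> g \<noteq> 0 \<Longrightarrow> ord q (f / g) = ord q f - ord q g"
  by (simp add: divide_inverse ord_mult)

lemma ord_power: "ord q (f ^ n) = int n * ord q f"
  by (cases "f = 0") (induction n; simp add: ord_mult algebra_simps power_0_left)+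

lemma ord_prod: "(\<And>i. i \<in> I \<Longrightarrow> f i \<noteq> 0) \<Longrightarrow> ord q (\<Prod>i\<in>I. f i) = (\<Sum>i\<in>I. ord q (f i))"
  by (induction I rule: infinite_finite_induct) (simp_all add: ord_mult)

lemma ord_power_int: "ord q (f powi k) = k * ord q f"
  by (cases "f = 0") (simp_all add: power_int_def ord_power power_0_left)

lemma expansion_nth_below: "k < ord q f \<Longrightarrow> coeff_at q k f = 0"
  by (simp add: ord_def)

lemma ord_geI: "f \<noteq> 0 \<Longrightarrow> (\<And>k. k < n \<Longrightarrow> coeff_at q k f = 0) \<Longrightarrow> n \<le> ord q f"
  by (simp add: ord_def fls_subdegree_geI)

text \<open>Encoded by vanishing coefficients because \<open>ord q 0 = 0\<close> by convention: in
  this form 0 belongs to every level and each level is visibly a subspace.\<close>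

definition ord_ge :: "int \<Rightarrow> p1 \<Rightarrow> ratfun set" where
  "ord_ge n q = {f. \<forall>k<n. coeff_at q k f = 0}"

lemma ord_ge_iff: "f \<in> ord_ge n q \<longleftrightarrow> f = 0 \<or> n \<le> ord q f"
  by (auto simp: ord_ge_def expansion_nth_below intro: ord_geI)

lemma local_ring_ord_ge: "p1_local_ring q = ord_ge 0 q"
  by (auto simp: p1_local_ring_def ord_ge_iff simp flip: ord_def)

lemma ord_ge_add: "f \<in> ord_ge n q \<Longrightarrow> g \<in> ord_ge n q \<Longrightarrow> f + g \<in> ord_ge n q"
  and ord_ge_diff: "f \<in> ord_ge n q \<Longrightarrow> g \<in> ord_ge n q \<Longrightarrow> f - g \<in> ord_ge n q"
  and ord_ge_uminus: "f \<in> ord_ge n q \<Longrightarrow> - f \<in> ord_ge n q"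
  and ord_ge_cscale: "f \<in> ord_ge n q \<Longrightarrow> cscale c f \<in> ord_ge n q"
  and ord_ge_0 [simp]: "0 \<in> ord_ge n q"
  by (simp_all add: ord_ge_def expansion_add expansion_diff expansion_uminus expansion_cscale)

lemma ord_ge_mult: "f \<in> ord_ge m q \<Longrightarrow> g \<in> ord_ge n q \<Longrightarrow> f * g \<in> ord_ge (m + n) q"
  by (cases "f = 0"; cases "g = 0") (auto simp: ord_ge_iff ord_mult)

lemma ord_ge_mono: "f \<in> ord_ge m q \<Longrightarrow> n \<le> m \<Longrightarrow> f \<in> ord_ge n q"
  by (auto simp: ord_ge_iff)

lemma ord_ge_Suc: "f \<in> ord_ge (n + 1) q \<longleftrightarrow> f \<in> ord_ge n q \<and> coeff_at q n f = 0"
  by (auto simp: ord_ge_def order.order_iff_strict intro: less_trans)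

text \<open>The bounds \<open>m\<close> and \<open>n\<close> may fail to be sharp: if one of them is
  strict, both sides vanish. The case \<open>m = n = 0\<close> is multiplicativity of values, and
  \<open>n = - 1\<close> with \<open>m = 0\<close> is the rule for residues at simple poles.\<close>

lemma expansion_nth_mult:
  assumes "f \<in> ord_ge m q" "g \<in> ord_ge n q"
  shows "coeff_at q (m + n) (f * g) = coeff_at q m f * coeff_at q n g"
proof (cases "f = 0 \<or> g = 0")
  case False
  show ?thesis
  proof (cases "ord q f = m \<and> ord q g = n")
    case True
    then show ?thesis
      using False fls_times_base[of "expansion q f" "expansion q g"]
      by (auto simp: expansion_mult ord_def)
  next
    case neq: False
    then have "m + n < ord q (f * g)"
      using False assms by (auto simp: ord_mult ord_ge_iff)
    moreover have "m < ord q f \<or> n < ord q g"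
      using False assms neq by (auto simp: ord_ge_iff)
    ultimately show ?thesis
      by (auto simp: expansion_nth_below)
  qed
qed auto

lemma leading_nonzero: "f \<noteq> 0 \<Longrightarrow> coeff_at q (ord q f) f \<noteq> 0"
  by (simp add: ord_def)

lemma ord_eqI: "f \<in> ord_ge n q \<Longrightarrow> coeff_at q n f \<noteq> 0 \<Longrightarrow> ord q f = n"
  by (metis expansion_0 expansion_nth_below fls_zero_nth not_less_iff_gr_or_eq ord_ge_iff order_le_less)


section \<open>The derivation and divisors on the projective line\<close>

text \<open>Well-definedness of the quotient rule: differentiating the cross relation
  \<open>a * r = p * b\<close> allows \<open>pderiv a\<close> to be eliminated.\<close>

lemma fract_deriv_Fract:
  assumes "r \<noteq> 0"
  shows "fract_deriv (Fract p r) = Fract (pderiv p * r - p * pderiv r) (r * r)"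
proof -
  obtain a b where ab: "quot_of_fract (Fract p r) = (a, b)"
    by fastforce
  have b: "b \<noteq> 0" "Fract a b = Fract p r"
    using snd_quot_of_fract_nonzero[of "Fract p r"] Fract_quot_of_fract[of "Fract p r"]
    by (simp_all add: ab)
  then have eq: "a * r = p * b"
    using assms by (simp add: eq_fract)
  then have "pderiv (a * r) = pderiv (p * b)"
    by simp
  then have "a * pderiv r + r * pderiv a = p * pderiv b + b * pderiv p"
    by (simp add: pderiv_mult)
  then have ra: "r * pderiv a = p * pderiv b + b * pderiv p - a * pderiv r"
    by (simp add: algebra_simps)
  have "(pderiv a * b - a * pderiv b) * (r * r) = b * r * (r * pderiv a) - a * r * (r * pderiv b)"
    by (simp add: algebra_simps)
  also have "\<dots> = b * r * (p * pderiv b + b * pderiv p - a * pderiv r) - p * b * (r * pderiv b)"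
    by (simp only: ra eq)
  also have "\<dots> = b * r * (b * pderiv p) - b * pderiv r * (a * r)"
    by (simp add: algebra_simps)
  also have "\<dots> = (pderiv p * r - p * pderiv r) * (b * b)"
    by (simp add: eq algebra_simps)
  finally have "(pderiv a * b - a * pderiv b) * (r * r) = (pderiv p * r - p * pderiv r) * (b * b)" .
  then show ?thesis
    using assms b(1) by (simp add: fract_deriv_def ab eq_fract)
qed

lemma fls_deriv_poly_at: "fls_deriv (poly_at q p) = poly_at q (pderiv p) * fls_deriv (coordinate_at q)"
  by (induction p) (simp_all add: pderiv_pCons poly_at_add algebra_simps)

text \<open>The chain rule d/ds = (dt/ds) d/dt. For a fraction it follows by differentiating
  \<open>Q * R = P\<close>, with the polynomial case as input.\<close>

lemma expansion_fract_deriv: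
  "expansion q (fract_deriv f) * fls_deriv (coordinate_at q) = fls_deriv (expansion q f)"
proof -
  obtain p r where pr: "r \<noteq> 0" "f = Fract p r"
    by (metis ratfun_cases)
  define P R c Q where defs: "P = poly_at q p" "R = poly_at q r" "c = fls_deriv (coordinate_at q)"
    "Q = poly_at q p / poly_at q r"
  have R: "R \<noteq> 0"
    using pr by (simp add: defs)
  have "fls_deriv (Q * R) = fls_deriv P"
    using R by (simp add: defs)
  then have "fls_deriv Q * R + Q * fls_deriv R = fls_deriv P"
    by (simp add: add.commute)
  moreover have "Q * R = P"
    using R by (simp add: defs)
  moreover have "fls_deriv P = poly_at q (pderiv p) * c" "fls_deriv R = poly_at q (pderiv r) * c"
    by (simp_all add: defs fls_deriv_poly_at)
  ultimately have *: "fls_deriv Q * R + Q * (poly_at q (pderiv r) * c) = poly_at q (pderiv p) * c"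
    by simp
  have "fls_deriv Q * (R * R) + P * (poly_at q (pderiv r) * c) =
      (fls_deriv Q * R + Q * (poly_at q (pderiv r) * c)) * R"
    unfolding \<open>Q * R = P\<close>[symmetric] by (simp add: algebra_simps)
  also have "\<dots> = poly_at q (pderiv p) * c * R"
    by (simp only: *)
  finally have "fls_deriv Q * (R * R) = (poly_at q (pderiv p) * R - P * poly_at q (pderiv r)) * c"
    by (simp add: algebra_simps)
  then have "fls_deriv Q = (poly_at q (pderiv p) * R - P * poly_at q (pderiv r)) / (R * R) * c"
    using R by (simp add: field_simps)
  then show ?thesis
    using pr by (simp add: fract_deriv_Fract expansion_Fract poly_at_diff poly_at_mult defs)
qed

text \<open>Minus the order of dt, which has a double pole at infinity because dt = - ds / s^2. Thus
  h dt is regular at \<open>q\<close> iff \<open>h\<close> lies in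
  \<open>ord_ge (kappa q) q\<close>.\<close>

definition kappa :: "p1 \<Rightarrow> int" where
  "kappa q = (if q = None then 2 else 0)"

lemma deriv_coordinate_nonzero [simp]: "fls_deriv (coordinate_at q) \<noteq> 0"
  by (cases q) (simp_all add: coordinate_at_def)

lemma subdegree_deriv_coordinate [simp]: "fls_subdegree (fls_deriv (coordinate_at q)) = - kappa q"
  by (cases q) (simp_all add: coordinate_at_def kappa_def fls_subdegree_pow)

text \<open>Expansion at a single point is injective, so derivation rules can be imported from
  formal Laurent series; the point \<open>None\<close> used for this below is an arbitrary
  choice.\<close>

lemma fract_deriv_eqI:
  assumes "fls_deriv (expansion q f) = expansion q g * fls_deriv (coordinate_at q)"
  shows "fract_deriv f = g"
  using assms by (simp add: expansion_eq_iff flip: expansion_fract_deriv)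

lemma fract_deriv_add: "fract_deriv (f + g) = fract_deriv f + fract_deriv g"
  by (rule fract_deriv_eqI[of None])
    (simp add: expansion_add distrib_right expansion_fract_deriv)

lemma fract_deriv_mult: "fract_deriv (f * g) = fract_deriv f * g + f * fract_deriv g"
proof (rule fract_deriv_eqI[of None])
  show "fls_deriv (expansion None (f * g)) =
      expansion None (fract_deriv f * g + f * fract_deriv g) * fls_deriv (coordinate_at None)"
    unfolding expansion_add expansion_mult distrib_right fls_deriv_mult
      expansion_fract_deriv[symmetric]
    by (simp add: algebra_simps)
qed

lemma fract_deriv_const [simp]: "fract_deriv (const_fun c) = 0"
  by (rule fract_deriv_eqI[of None]) simp

lemma fract_deriv_0 [simp]: "fract_deriv 0 = 0" and fract_deriv_1 [simp]: "fract_deriv 1 = 0"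
  using fract_deriv_const[of 0] fract_deriv_const[of 1] by simp_all

lemma fract_deriv_cscale: "fract_deriv (cscale c f) = cscale c (fract_deriv f)"
  by (simp add: cscale_def fract_deriv_mult)

lemma fract_deriv_sum: "fract_deriv (\<Sum>i\<in>I. f i) = (\<Sum>i\<in>I. fract_deriv (f i))"
  by (induction I rule: infinite_finite_induct) (simp_all add: fract_deriv_add)

lemma fract_deriv_eq_0D:
  assumes "fract_deriv f = 0"
  obtains c where "f = const_fun c"
proof -
  have "fls_deriv (expansion None f) = 0"
    using assms by (simp flip: expansion_fract_deriv)
  then have "expansion None f = expansion None (const_fun (coeff_at None 0 f))"
    by (simp add: fls_deriv_eq_0_iff)
  then show thesis
    by (simp only: expansion_eq_iff that)
qed

section \<open>Divisors on the projective line and Riemann-Roch in genus 0\<close>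

lemma ord_Some_to_fract: "p \<noteq> 0 \<Longrightarrow> ord (Some a) (to_fract p) = int (order a p)"
  by (simp add: ord_def expansion_to_fract poly_at_Some)

lemma ord_None_to_fract: "p \<noteq> 0 \<Longrightarrow> ord None (to_fract p) = - int (degree p)"
  by (simp add: ord_def expansion_to_fract poly_at_None)

lemma infinite_p1: "infinite (UNIV :: p1 set)"
  using infinite_UNIV_char_0[where 'a = complex] by simp

text \<open>Over the complex numbers the zeros of a polynomial, counted with multiplicity, number
  its degree, which is the order of its pole at infinity. \<open>T\<close> may be any finite set
  containing the support, hence the comparison with the explicit set \<open>U\<close>.\<close>

lemma principal_divisor_degree:
  assumes f: "f \<noteq> 0" and T: "finite T" "\<And>q. q \<notin> T \<Longrightarrow> ord q f = 0"
  shows "(\<Sum>q\<in>T. ord q f) = 0"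
proof -
  obtain p r where pr: "r \<noteq> 0" "f = Fract p r"
    by (metis ratfun_cases)
  have p: "p \<noteq> 0"
    using f pr by (auto simp: Zero_fract_def eq_fract)
  define R where "R = {a. poly p a = 0} \<union> {a. poly r a = 0}"
  define U where "U = insert None (Some ` R)"
  have R: "finite R"
    using p pr by (simp add: R_def poly_roots_finite)
  have ordf: "ord q f = ord q (to_fract p) - ord q (to_fract r)" for q
    using p pr by (simp add: Fract_conv_to_fract ord_divide)
  have deg: "(\<Sum>q\<in>U. ord q (to_fract s)) = 0" if s: "s \<noteq> 0" "{a. poly s a = 0} \<subseteq> R" for s
  proof -
    have "int (degree s) = int (\<Sum>a | poly s a = 0. order a s)"
      using s by (simp add: size_multiset_overloaded_eq flip: size_proots_complex)
    also have "\<dots> = (\<Sum>a\<in>R. int (order a s))"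
      unfolding of_nat_sum
      by (rule sum.mono_neutral_left) (use R s in \<open>auto simp: order_root\<close>)
    finally show ?thesis
      using R s by (simp add: U_def sum.reindex ord_None_to_fract ord_Some_to_fract)
  qed
  have 0: "(\<Sum>q\<in>U. ord q f) = 0"
    unfolding ordf using deg[of p] deg[of r] p pr(1) by (simp add: sum_subtractf R_def)
  have Uf: "ord q f = 0" if "q \<notin> U" for q
    unfolding ordf using that p pr(1)
    by (cases q) (auto simp: U_def R_def ord_Some_to_fract order_0I image_iff)
  have "(\<Sum>q\<in>T. ord q f) = (\<Sum>q\<in>T \<union> U. ord q f)"
    by (rule sum.mono_neutral_left) (use T R in \<open>auto simp: U_def\<close>)
  also have "\<dots> = (\<Sum>q\<in>U. ord q f)"
    by (rule sum.mono_neutral_right) (use T R Uf in \<open>auto simp: U_def\<close>)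
  finally show ?thesis
    using 0 by simp
qed

text \<open>Powers of the linear forms t - a realize the finite part; the order at infinity is then
  minus the sum of the exponents, which is what degree 0 asks for.\<close>

lemma divisor_degree_0_principal:
  assumes T: "finite T" "\<And>q. q \<notin> T \<Longrightarrow> e q = 0" and e: "(\<Sum>q\<in>T. e q) = 0"
  obtains h where "h \<noteq> 0" "\<And>q. ord q h = e q"
proof -
  define A where "A = {a. Some a \<in> T}"
  define h where "h = (\<Prod>a\<in>A. to_fract [:-a, 1:] powi e (Some a))"
  have A: "finite A"
    using finite_vimageI[OF T(1), of Some] by (simp add: A_def vimage_def)
  have h: "h \<noteq> 0"
    using A by (simp add: h_def)
  have ordh: "ord q h = (\<Sum>a\<in>A. e (Some a) * ord q (to_fract [:-a, 1:]))" for q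
    unfolding h_def by (subst ord_prod) (simp_all add: ord_power_int)
  have Some: "ord (Some b) h = e (Some b)" for b
  proof -
    have "ord (Some b) (to_fract [:-a, 1:]) = (if a = b then 1 else 0)" for a
      using order_power_n_n[of a 1] by (auto simp: ord_Some_to_fract order_0I)
    then have "ord (Some b) h = (\<Sum>a\<in>A. if a = b then e (Some a) else 0)"
      unfolding ordh by (intro sum.cong) auto
    also have "\<dots> = e (Some b)"
      using A T(2) by (simp add: A_def)
    finally show ?thesis .
  qed
  have "(\<Sum>q\<in>insert None (Some ` A). e q) = (\<Sum>q\<in>T. e q)"
  proof (rule sum.mono_neutral_right)
    show "T \<subseteq> insert None (Some ` A)"
      by (auto simp: A_def image_iff) (metis option.exhaust)
  qed (use A T in auto)
  then have "e None + (\<Sum>a\<in>A. e (Some a)) = 0"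
    using A e by (simp add: sum.reindex)
  then have "ord None h = e None"
    unfolding ordh by (simp add: ord_None_to_fract sum_negf)
  with Some have "ord q h = e q" for q
    by (cases q) auto
  with h that show thesis
    by blast
qed

lemma prescribed_orders:
  assumes "finite Q"
  obtains h where "h \<noteq> 0" "\<And>q. q \<in> Q \<Longrightarrow> ord q h = e q"
proof -
  obtain c where c: "c \<notin> Q"
    using ex_new_if_finite[OF infinite_p1 assms] by blast
  \<comment> \<open>The auxiliary point \<open>c\<close> absorbs the total degree, so that arbitrary
    orders on \<open>Q\<close> extend to a divisor of degree 0.\<close>
  define e' where "e' q = (if q \<in> Q then e q else if q = c then - (\<Sum>q\<in>Q. e q) else 0)" for q
  have "(\<Sum>q\<in>insert c Q. e' q) = 0"
    using assms c by (simp add: e'_def)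
  then obtain h where "h \<noteq> 0" "\<And>q. ord q h = e' q"
    using divisor_degree_0_principal[of "insert c Q" e'] assms by (auto simp: e'_def)
  then show thesis
    using that by (simp add: e'_def)
qed

lemma prescribed_order:
  obtains h where "h \<noteq> 0" "ord q h = k"
  using prescribed_orders[of "{q}" "\<lambda>_. k"] by auto

text \<open>In lowest terms a root of the denominator is no root of the numerator, so it would be a
  pole.\<close>

lemma regular_on_affine_line:
  assumes f: "\<And>a. f \<in> ord_ge 0 (Some a)"
  obtains p where "f = to_fract p"
proof -
  obtain p r where pr: "quot_of_fract f = (p, r)"
    by fastforce
  have r: "r \<noteq> 0" "coprime p r" "f = Fract p r"
    using snd_quot_of_fract_nonzero[of f] coprime_quot_of_fract[of f] Fract_quot_of_fract[of f]
    by (simp_all add: pr)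
  have "degree r = 0"
  proof (rule ccontr)
    assume "degree r \<noteq> 0"
    then obtain a where a: "poly r a = 0"
      using fundamental_theorem_of_algebra[of r] constant_degree[of r] by auto
    have p: "poly p a \<noteq> 0"
      using a coprime_poly_0[OF r(2), of a] by simp
    then have "p \<noteq> 0"
      by auto
    then have "f \<noteq> 0" "ord (Some a) f = int (order a p) - int (order a r)"
      using r by (auto simp: Fract_conv_to_fract ord_divide ord_Some_to_fract)
    moreover have "order a p = 0" "order a r \<noteq> 0"
      using p a r by (auto simp: order_root)
    ultimately show False
      using f[of a] by (simp add: ord_ge_iff)
  qed
  then obtain c where c: "r = [:c:]"
    by (metis degree_eq_zeroE)
  then have "p * 1 = Polynomial.smult (inverse c) p * r"
    using r(1) by (simp add: field_simps)
  then have "f = to_fract (Polynomial.smult (inverse c) p)"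
    using r unfolding to_fract_def by (simp add: eq_fract)
  then show thesis
    by (rule that)
qed

lemma poly_as_sum_cscale:
  "to_fract (\<Sum>i\<le>N. monom (c i) i) = (\<Sum>i\<le>N. cscale (c i) (to_fract (monom 1 i)))"
  by (simp add: cscale_def const_fun_def smult_monom flip: to_fract_mult)

text \<open>Here \<open>e\<close> is minus a divisor of degree \<open>N\<close>. Shifting it by
  \<open>N\<close> at infinity gives the divisor of some \<open>h\<close>, and division by
  \<open>h\<close> turns the space into the polynomials of degree at most \<open>N\<close>, with the
  monomials as basis.\<close>

lemma riemann_roch_genus_0:
  assumes T: "finite T" "\<And>q. q \<notin> T \<Longrightarrow> e q = 0" and e: "(\<Sum>q\<in>T. e q) = - int N"
  obtains S where "finite S" "card S = N + 1" "ratfun.independent S"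
    "ratfun.span S = {f. \<forall>q. f \<in> ord_ge (e q) q}"
proof -
  define e' where "e' q = e q + (if q = None then int N else 0)" for q
  have "(\<Sum>q\<in>insert None T. e q) = (\<Sum>q\<in>T. e q)"
    by (rule sum.mono_neutral_right) (use T in auto)
  then have "(\<Sum>q\<in>insert None T. e' q) = 0"
    using T e by (simp add: e'_def sum.distrib)
  moreover have "e' q = 0" if "q \<notin> insert None T" for q
    using that T by (cases q) (simp_all add: e'_def)
  ultimately obtain h where h: "h \<noteq> 0" "\<And>q. ord q h = e' q"
    using divisor_degree_0_principal[of "insert None T" e'] T by blast
  define s where "s k = h * to_fract (monom 1 k)" for k
  define S where "S = s ` {..N}"
  have inj: "inj s"
    using h by (auto simp: s_def inj_def monom_eq_iff')
  have inj': "inj_on s {..N}"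
    using inj by (rule inj_on_subset) simp
  have fS: "finite S" and card: "card S = N + 1"
    using inj' by (simp_all add: S_def card_image)
  have comb: "(\<Sum>v\<in>S. cscale (c v) v) = h * to_fract (\<Sum>i\<le>N. monom (c (s i)) i)" for c
    unfolding S_def sum.reindex[OF inj']
    by (auto simp: poly_as_sum_cscale sum_distrib_left s_def cscale_def mult_ac
        simp del: to_fract_sum)
  have "ratfun.independent S"
  proof (rule ratfun.independent_if_scalars_zero[OF fS])
    fix c v
    assume "(\<Sum>v\<in>S. cscale (c v) v) = 0" and v: "v \<in> S"
    then have 0: "(\<Sum>i\<le>N. monom (c (s i)) i) = 0"
      unfolding comb using h by (simp del: to_fract_sum)
    from v obtain k where k: "k \<le> N" "v = s k"
      by (auto simp: S_def)
    have "coeff (\<Sum>i\<le>N. monom (c (s i)) i) k = c (s k)"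
      using k by (simp add: coeff_sum if_distrib cong: if_cong)
    with 0 k show "c v = 0"
      by simp
  qed
  moreover have "ratfun.span S = {f. \<forall>q. f \<in> ord_ge (e q) q}"
  proof (intro equalityI subsetI)
    fix f
    assume "f \<in> ratfun.span S"
    then obtain c where f: "f = h * to_fract (\<Sum>i\<le>N. monom (c (s i)) i)" (is "f = h * to_fract ?p")
      using comb by (auto simp: ratfun.span_finite[OF fS])
    have deg: "degree ?p \<le> N"
      by (intro degree_sum_le) (auto intro: order_trans[OF degree_monom_le])
    show "f \<in> {f. \<forall>q. f \<in> ord_ge (e q) q}"
    proof (cases "?p = 0")
      case False
      then have "e q \<le> ord q f" for q
        unfolding f using h deg
        by (cases q) (simp_all add: ord_mult e'_def ord_None_to_fract ord_Some_to_fract del: to_fract_sum)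
      then show ?thesis
        by (simp add: ord_ge_iff)
    qed (simp add: f del: to_fract_sum)
  next
    fix f
    assume f: "f \<in> {f. \<forall>q. f \<in> ord_ge (e q) q}"
    have "inverse h \<in> ord_ge (- e' q) q" for q
      using h by (simp add: ord_ge_iff)
    then have fh: "f * inverse h \<in> ord_ge (e q - e' q) q" for q
      using f ord_ge_mult[of f "e q" q "inverse h" "- e' q"] by simp
    then have "f * inverse h \<in> ord_ge 0 (Some a)" for a
      using fh[of "Some a"] by (simp add: e'_def)
    then obtain p where p: "f * inverse h = to_fract p"
      using regular_on_affine_line by blast
    then have f': "f = h * to_fract p"
      using h by (simp add: field_simps)
    have deg: "degree p \<le> N"
      using fh[of None] p by (cases "p = 0") (auto simp: ord_ge_iff ord_None_to_fract e'_def)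
    have "p = (\<Sum>i\<le>N. monom (coeff p i) i)"
      using poly_as_sum_of_monoms'[OF deg] by simp
    then have "f = (\<Sum>v\<in>S. cscale (coeff p (inv_into UNIV s v)) v)"
      using inj unfolding comb f' by simp
    then show "f \<in> ratfun.span S"
      by (simp add: ratfun.span_finite[OF fS])
  qed
  ultimately show thesis
    using that fS card by blast
qed


section \<open>Dimensions of quotients\<close>

lemma cscale_linear:
  "cscale c (f + g) = cscale c f + cscale c g"
  "cscale c (f - g) = cscale c f - cscale c g"
  "cscale (a + b) f = cscale a f + cscale b f"
  "cscale (a - b) f = cscale a f - cscale b f"
  "cscale a (cscale b f) = cscale (a * b) f"
  "cscale 0 f = 0" "cscale c 0 = 0" "cscale 1 f = f"
  by (simp_all add: ratfun.scale_right_distrib ratfun.scale_right_diff_distrib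
      ratfun.scale_left_distrib ratfun.scale_left_diff_distrib)

lemma coeff_at_cscale: "coeff_at q n (cscale c f) = c * coeff_at q n f"
  by (simp add: expansion_cscale)

lemma quotient_basis_refl: "ratfun.subspace A \<Longrightarrow> quotient_basis A A {}"
  unfolding quotient_basis_def by (auto intro!: ex1I[of _ "\<lambda>_. 0"])

text \<open>One step of a flag: \<open>l\<close> has one-dimensional image, so a vector outside its
  kernel extends a basis of the kernel modulo \<open>B\<close>.\<close>

lemma quotient_basis_insert:
  assumes A: "ratfun.subspace A" and a: "a \<in> A" "l a \<noteq> 0"
    and l: "\<And>f g. f \<in> A \<Longrightarrow> g \<in> A \<Longrightarrow> l (f + g) = l f + l g"
      "\<And>c f. f \<in> A \<Longrightarrow> l (cscale c f) = (c::complex) * l f"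
    and B: "B \<subseteq> {f \<in> A. l f = 0}"
    and S: "quotient_basis {f \<in> A. l f = 0} B S"
  shows "quotient_basis A B (insert a S)" and "card (insert a S) = Suc (card S)"
proof -
  let ?A' = "{f \<in> A. l f = 0}"
  have fS: "finite S" and SA: "S \<subseteq> ?A'"
    using S by (auto simp: quotient_basis_def)
  have ldiff: "l (f - g) = l f - l g" if "f \<in> A" "g \<in> A" for f g
  proof -
    have "l (f + cscale (-1) g) = l f + (-1) * l g"
      using l that A by (metis ratfun.subspace_scale)
    then show ?thesis
      by simp
  qed
  have aS: "a \<notin> S"
    using SA a by auto
  then show "card (insert a S) = Suc (card S)"
    using fS by simp
  have combA: "(\<Sum>s\<in>S. cscale (c s) s) \<in> A" for c
    using SA by (intro ratfun.subspace_sum[OF A] ratfun.subspace_scale[OF A]) auto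
  have lcomb: "l (\<Sum>s\<in>S. cscale (c s) s) = 0" for c
    using fS SA
  proof (induction S rule: finite_induct)
    case empty
    show ?case
      using l(2)[OF a(1), of 0] by simp
  next
    case (insert s S)
    have "(\<Sum>s\<in>S. cscale (c s) s) \<in> A"
      using insert.prems by (intro ratfun.subspace_sum[OF A] ratfun.subspace_scale[OF A]) auto
    moreover have "cscale (c s) s \<in> A"
      using insert.prems A ratfun.subspace_scale by blast
    ultimately show ?case
      using insert l by simp
  qed
  have "\<exists>!c. (\<forall>s. s \<notin> insert a S \<longrightarrow> c s = 0) \<and> f - (\<Sum>s\<in>insert a S. cscale (c s) s) \<in> B"
    if f: "f \<in> A" for f
  proof -
    \<comment> \<open>Applying \<open>l\<close> forces this coefficient of \<open>a\<close>, since
      \<open>l\<close> kills both \<open>S\<close> and \<open>B\<close>.\<close>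
    define k where "k = l f / l a"
    have ka: "cscale k a \<in> A"
      using a A ratfun.subspace_scale by blast
    then have "f - cscale k a \<in> ?A'"
      using f A a by (simp add: ratfun.subspace_diff ldiff l k_def)
    then have ex: "\<exists>!c. (\<forall>s. s \<notin> S \<longrightarrow> c s = 0) \<and> f - cscale k a - (\<Sum>s\<in>S. cscale (c s) s) \<in> B"
      using S unfolding quotient_basis_def by blast
    then obtain c where c: "\<forall>s. s \<notin> S \<longrightarrow> c s = 0" "f - cscale k a - (\<Sum>s\<in>S. cscale (c s) s) \<in> B"
      by auto
    have upd: "(\<Sum>s\<in>S. cscale ((d(a := x)) s) s) = (\<Sum>s\<in>S. cscale (d s) s)" for d x
      using aS by (intro sum.cong) auto
    show ?thesis
    proof (rule ex1I[of _ "c(a := k)"])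
      show "(\<forall>s. s \<notin> insert a S \<longrightarrow> (c(a := k)) s = 0) \<and>
          f - (\<Sum>s\<in>insert a S. cscale ((c(a := k)) s) s) \<in> B"
        using c fS aS upd[of c k] by (simp add: algebra_simps del: fun_upd_apply)
          (simp add: algebra_simps)
    next
      fix d
      assume d: "(\<forall>s. s \<notin> insert a S \<longrightarrow> d s = 0) \<and>
          f - (\<Sum>s\<in>insert a S. cscale (d s) s) \<in> B"
      then have dB: "f - cscale (d a) a - (\<Sum>s\<in>S. cscale (d s) s) \<in> B"
        using fS aS by (simp add: algebra_simps)
      have da: "cscale (d a) a \<in> A"
        using a A ratfun.subspace_scale by blast
      then have "f - cscale (d a) a \<in> A"
        using f A ratfun.subspace_diff by blast
      then have "l (f - cscale (d a) a - (\<Sum>s\<in>S. cscale (d s) s)) = l f - d a * l a"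
        using f a da combA lcomb by (simp add: ldiff l)
      moreover have "l (f - cscale (d a) a - (\<Sum>s\<in>S. cscale (d s) s)) = 0"
        using dB B by auto
      ultimately have k: "d a = k"
        using a by (simp add: k_def)
      define d' where "d' = d(a := 0)"
      have "(\<forall>s. s \<notin> S \<longrightarrow> d' s = 0) \<and> f - cscale k a - (\<Sum>s\<in>S. cscale (d' s) s) \<in> B"
        using d dB upd[of d 0] by (auto simp: d'_def k simp del: fun_upd_apply) (auto)
      then have "d' = c"
        using ex c by blast
      then show "d = c(a := k)"
        using k by (metis d'_def fun_upd_triv fun_upd_upd)
    qed
  qed
  then show "quotient_basis A B (insert a S)"
    using fS SA a by (auto simp: quotient_basis_def)
qed

text \<open>Exchange argument behind the uniqueness required by \<open>quotient_dim\<close>: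
  representatives of \<open>S\<close> modulo \<open>B\<close> inside the span of \<open>S'\<close>
  are independent, because a relation between them would give a second expression of 0 modulo
  \<open>B\<close>.\<close>

lemma quotient_basis_card_le:
  assumes B: "ratfun.subspace B" and S: "quotient_basis A B S" and S': "quotient_basis A B S'"
    and A: "ratfun.subspace A"
  shows "card S \<le> card S'"
proof -
  have fS: "finite S" "S \<subseteq> A" and fS': "finite S'" "S' \<subseteq> A"
    using S S' by (auto simp: quotient_basis_def)
  have "\<forall>s\<in>S. \<exists>t \<in> ratfun.span S'. s - t \<in> B"
  proof
    fix s
    assume "s \<in> S"
    then have "s \<in> A"
      using fS by auto
    then obtain c where "s - (\<Sum>s\<in>S'. cscale (c s) s) \<in> B"
      using S' unfolding quotient_basis_def by blast
    moreover have "(\<Sum>s\<in>S'. cscale (c s) s) \<in> ratfun.span S'"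
      by (intro ratfun.span_sum ratfun.span_scale ratfun.span_base)
    ultimately show "\<exists>t \<in> ratfun.span S'. s - t \<in> B"
      by blast
  qed
  then obtain T where T: "\<And>s. s \<in> S \<Longrightarrow> T s \<in> ratfun.span S'" "\<And>s. s \<in> S \<Longrightarrow> s - T s \<in> B"
    by metis
  have zero: "c s = 0" if c: "(\<Sum>s\<in>S. cscale (c s) (T s)) = 0" and s: "s \<in> S" for c s
  proof -
    have "(\<Sum>s\<in>S. cscale (c s) (s - T s)) \<in> B"
      using T by (intro ratfun.subspace_sum[OF B] ratfun.subspace_scale[OF B])
    then have "(\<Sum>s\<in>S. cscale (c s) s) \<in> B"
      using c by (simp add: cscale_linear sum_subtractf)
    then have "0 - (\<Sum>s\<in>S. cscale (- c s) s) \<in> B"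
      by (simp add: sum_negf)
    \<comment> \<open>Uniqueness in \<open>quotient_basis\<close> concerns coefficient functions
      vanishing outside \<open>S\<close>, so the relation is cut off there before it is compared
      with the zero function.\<close>
    then have 1: "0 - (\<Sum>s\<in>S. cscale ((\<lambda>s. if s \<in> S then - c s else 0) s) s) \<in> B"
      by (simp cong: sum.cong)
    have 2: "0 - (\<Sum>s\<in>S. cscale ((\<lambda>s. 0) s) s) \<in> B"
      using B by (simp add: ratfun.subspace_0)
    have "0 \<in> A"
      using A by (rule ratfun.subspace_0)
    define P where
      "P c \<longleftrightarrow> (\<forall>s. s \<notin> S \<longrightarrow> c s = 0) \<and> 0 - (\<Sum>s\<in>S. cscale (c s) s) \<in> B" for c
    have "\<exists>!c. P c"
      using S \<open>0 \<in> A\<close> unfolding quotient_basis_def P_def by blast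
    moreover have "P (\<lambda>s. if s \<in> S then - c s else 0)" "P (\<lambda>s. 0)"
      using 1 2 by (simp_all add: P_def)
    ultimately have "(\<lambda>s. if s \<in> S then - c s else 0) = (\<lambda>s. 0)"
      by blast
    then show ?thesis
      using s by (auto simp: fun_eq_iff split: if_splits)
  qed
  have inj: "inj_on T S"
  proof (rule inj_onI, rule ccontr)
    fix s t
    assume st: "s \<in> S" "t \<in> S" "T s = T t" "s \<noteq> t"
    define c where "c = (\<lambda>x. if x = s then 1 else if x = t then - 1 else 0 :: complex)"
    have "(\<Sum>x\<in>S. cscale (c x) (T x)) = (\<Sum>x\<in>{s, t}. cscale (c x) (T x))"
      using fS st by (intro sum.mono_neutral_right) (auto simp: c_def)
    also have "\<dots> = 0"
      using st by (simp add: c_def)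
    finally have "c s = 0"
      using zero st by blast
    then show False
      by (simp add: c_def)
  qed
  have "ratfun.independent (T ` S)"
  proof (rule ratfun.independent_if_scalars_zero)
    fix c v
    assume "(\<Sum>x\<in>T ` S. cscale (c x) x) = 0" and "v \<in> T ` S"
    then show "c v = 0"
      using zero[of "c \<circ> T"] by (auto simp: sum.reindex[OF inj])
  qed (use fS in simp)
  moreover have "T ` S \<subseteq> ratfun.span S'"
    using T by auto
  ultimately show ?thesis
    using ratfun.independent_span_bound[OF fS'(1)] card_image[OF inj] by metis
qed

lemma quotient_dim_eqI:
  assumes "ratfun.subspace A" "ratfun.subspace B" "quotient_basis A B S" "card S = n"
  shows "quotient_dim A B = n"
  unfolding quotient_dim_def
proof (rule the_equality)
  show "\<exists>S. quotient_basis A B S \<and> card S = n"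
    using assms by blast
next
  fix k
  assume "\<exists>S. quotient_basis A B S \<and> card S = k"
  then show "k = n"
    using assms quotient_basis_card_le by (metis order_antisym)
qed

lemma subspace_ord_ge: "ratfun.subspace (ord_ge n q)"
  by (intro ratfun.subspaceI) (simp_all add: ord_ge_add ord_ge_cscale)

lemma quotient_basis_coeff_step:
  assumes A: "ratfun.subspace A" and A': "A' = {f \<in> A. coeff_at q n f = 0}"
    and a: "a \<in> A" "coeff_at q n a \<noteq> 0" and B: "B \<subseteq> A'"
    and ex: "\<exists>S. quotient_basis A' B S \<and> card S = k"
  shows "\<exists>S. quotient_basis A B S \<and> card S = Suc k"
proof -
  obtain S where S: "quotient_basis A' B S" "card S = k"
    using ex by blast
  note * = quotient_basis_insert[where l = "\<lambda>f. coeff_at q n f", OF A a(1) a(2), of B S]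
  show ?thesis
    using S * B unfolding A' by (auto simp: expansion_add coeff_at_cscale intro!: exI[of _ "insert a S"])
qed

text \<open>Raising the bound on the order at \<open>a\<close> by one cuts out the kernel of a coefficient functional.\<close>

lemma quotient_basis_ord_ge_Int:
  assumes B: "ratfun.subspace B" "B \<subseteq> ord_ge (i + int k) a \<inter> M"
    and M: "ratfun.subspace M"
    and ex: "\<And>j. \<exists>f \<in> M. f \<noteq> 0 \<and> ord a f = j"
    and base: "\<exists>S. quotient_basis (ord_ge (i + int k) a \<inter> M) B S \<and> card S = n"
  shows "\<exists>S. quotient_basis (ord_ge i a \<inter> M) B S \<and> card S = k + n"
  using B base
proof (induction k arbitrary: n)
  case (Suc k)
  have eq: "ord_ge (i + int (Suc k)) a \<inter> M = {f \<in> ord_ge (i + int k) a \<inter> M. coeff_at a (i + int k) f = 0}"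
    using ord_ge_Suc[of _ "i + int k" a] by (auto simp: algebra_simps)
  obtain f where f: "f \<in> M" "f \<noteq> 0" "ord a f = i + int k"
    using ex by blast
  have "\<exists>S. quotient_basis (ord_ge (i + int k) a \<inter> M) B S \<and> card S = Suc n"
  proof (rule quotient_basis_coeff_step[OF _ eq])
    show "ratfun.subspace (ord_ge (i + int k) a \<inter> M)"
      by (intro ratfun.subspace_inter subspace_ord_ge M)
    show "f \<in> ord_ge (i + int k) a \<inter> M" "coeff_at a (i + int k) f \<noteq> 0"
      using f leading_nonzero[of f a] by (auto simp: ord_ge_iff)
    show "B \<subseteq> ord_ge (i + int (Suc k)) a \<inter> M"
      "\<exists>S. quotient_basis (ord_ge (i + int (Suc k)) a \<inter> M) B S \<and> card S = n"
      by fact+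
  qed
  moreover have "B \<subseteq> ord_ge (i + int k) a \<inter> M"
    using Suc.prems(2) unfolding eq by auto
  ultimately show ?case
    using Suc.IH[of "Suc n"] Suc.prems(1) by simp
qed simp


section \<open>Local rings of a nodal curve\<close>

lemma mem_times_image_iff: "f \<noteq> 0 \<Longrightarrow> h \<in> (*) f ` A \<longleftrightarrow> h / f \<in> A" for f :: ratfun
  by (auto simp: image_iff intro!: bexI[of _ "h / f"])

lemma divide_ord_ge_iff: "f \<noteq> 0 \<Longrightarrow> h / f \<in> ord_ge n q \<longleftrightarrow> h \<in> ord_ge (n + ord q f) q"
  by (cases "h = 0") (auto simp: ord_ge_iff ord_divide)

lemma quotient_dim_local_ring:
  assumes f: "f \<noteq> 0" "f \<in> ord_ge 0 q"
  shows "quotient_dim (ord_ge 0 q) ((*) f ` ord_ge 0 q) = nat (ord q f)"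
proof -
  have eq: "(*) f ` ord_ge 0 q = ord_ge (0 + int (nat (ord q f))) q \<inter> UNIV"
    using f by (intro Set.set_eqI) (simp add: mem_times_image_iff divide_ord_ge_iff ord_ge_iff[of f])
  have "\<exists>S. quotient_basis (ord_ge 0 q \<inter> UNIV) ((*) f ` ord_ge 0 q) S \<and> card S = nat (ord q f) + 0"
  proof (rule quotient_basis_ord_ge_Int)
    show "\<exists>S. quotient_basis (ord_ge (0 + int (nat (ord q f))) q \<inter> UNIV) ((*) f ` ord_ge 0 q) S
        \<and> card S = 0"
      unfolding eq by (rule exI[of _ "{}"]) (simp add: quotient_basis_refl subspace_ord_ge)
    show "\<exists>f\<in>UNIV. f \<noteq> 0 \<and> ord q f = j" for j
      by (rule prescribed_order[of q j]) auto
  qed (simp_all add: eq subspace_ord_ge)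
  then show ?thesis
    using quotient_dim_eqI[of "ord_ge 0 q" "(*) f ` ord_ge 0 q"] subspace_ord_ge
    by (auto simp: eq)
qed

lemma prescribed_order_pair:
  assumes "a \<noteq> b"
  obtains h where "h \<noteq> 0" "ord a h = i" "ord b h = j"
proof -
  obtain h where h: "h \<noteq> 0" "\<And>q. q \<in> {a, b} \<Longrightarrow> ord q h = (if q = a then i else j)"
    by (rule prescribed_orders[of "{a, b}" "\<lambda>q. if q = a then i else j"]) blast+
  show thesis
    using that[of h] h(1) h(2)[of a] h(2)[of b] assms by simp
qed

section \<open>The local ring of a node and its principal ideals\<close>

definition node_ring :: "p1 \<Rightarrow> p1 \<Rightarrow> ratfun set" where
  "node_ring a b = {f \<in> ord_ge 0 a \<inter> ord_ge 0 b. coeff_at a 0 f = coeff_at b 0 f}"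

lemma subspace_node_ring: "ratfun.subspace (node_ring a b)"
  by (intro ratfun.subspaceI)
    (auto simp: node_ring_def ord_ge_add ord_ge_cscale expansion_add expansion_cscale)

lemma one_in_node_ring: "1 \<in> node_ring a b"
  by (simp add: node_ring_def ord_ge_iff)

lemma coeff_at_0_mult:
  "f \<in> ord_ge 0 q \<Longrightarrow> g \<in> ord_ge 0 q \<Longrightarrow> coeff_at q 0 (f * g) = coeff_at q 0 f * coeff_at q 0 g"
  using expansion_nth_mult[of f 0 q g 0] by simp

lemma node_ring_mult: "f \<in> node_ring a b \<Longrightarrow> g \<in> node_ring a b \<Longrightarrow> f * g \<in> node_ring a b"
  using ord_ge_mult[of f 0 _ g 0] by (auto simp: node_ring_def coeff_at_0_mult)

lemma node_ring_nonunit: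
  assumes "f \<in> node_ring a b" "coeff_at a 0 f = 0"
  shows "f \<in> ord_ge 1 a" "f \<in> ord_ge 1 b"
  using assms ord_ge_Suc[of f 0] by (auto simp: node_ring_def)

text \<open>On either branch the value of \<open>h / f\<close> is the quotient of the coefficients
  of \<open>h\<close> and \<open>f\<close> at the order of \<open>f\<close>, so the gluing condition
  becomes one linear equation in coefficients of \<open>h\<close>.\<close>

lemma times_node_ring_nonunit:
  assumes f: "f \<noteq> 0"
  shows "(*) f ` node_ring a b = {h \<in> ord_ge (ord a f) a \<inter> ord_ge (ord b f) b.
    coeff_at a (ord a f) h / coeff_at a (ord a f) f = coeff_at b (ord b f) h / coeff_at b (ord b f) f}"
    (is "_ = ?R")
proof (rule Set.set_eqI)
  fix h
  have c: "coeff_at q (ord q f) h = coeff_at q (ord q f) f * coeff_at q 0 (h / f)"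
    if "h / f \<in> ord_ge 0 q" for q
    using expansion_nth_mult[of f "ord q f" q "h / f" 0] that f by (simp add: ord_ge_iff)
  show "h \<in> (*) f ` node_ring a b \<longleftrightarrow> h \<in> ?R"
    using f c[of a] c[of b] leading_nonzero[OF f, of a] leading_nonzero[OF f, of b]
    by (auto simp: mem_times_image_iff node_ring_def divide_ord_ge_iff)
qed

text \<open>Let O be the node ring and O' the functions regular on both branches. Then O' / O and f
  O' / f O are both one-dimensional, so O / f O has the dimension of O' / f O', the sum of the two
  orders. A unit is treated apart; for a nonunit the chain of subspaces passes through the maximal
  ideal and has 1 + (i + j) + 1 steps.\<close>

lemma quotient_dim_node_ring:
  assumes ab: "a \<noteq> b" and f: "f \<noteq> 0" "f \<in> node_ring a b"
  shows "quotient_dim (node_ring a b) ((*) f ` node_ring a b) = nat (ord a f + ord b f)"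
proof (cases "coeff_at a 0 f = 0")
  case False
  then have c: "coeff_at a 0 f \<noteq> 0" "coeff_at b 0 f = coeff_at a 0 f"
    using f by (auto simp: node_ring_def)
  then have o: "ord a f = 0" "ord b f = 0"
    using f by (auto intro!: ord_eqI simp: node_ring_def)
  have "(*) f ` node_ring a b = node_ring a b"
    unfolding times_node_ring_nonunit[OF f(1)] using c o by (auto simp: node_ring_def)
  then show ?thesis
    using quotient_dim_eqI[OF subspace_node_ring subspace_node_ring quotient_basis_refl] o
    by (simp add: subspace_node_ring)
next
  case True
  let ?B = "(*) f ` node_ring a b"
  \<comment> \<open>The maximal ideal already accounts for one order on each branch, hence the
    \<open>- 1\<close>.\<close>
  define i j where "i = nat (ord a f - 1)" and "j = nat (ord b f - 1)"
  have o: "ord a f = 1 + int i" "ord b f = 1 + int j"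
    using node_ring_nonunit[OF f(2) True] f(1) by (auto simp: ord_ge_iff i_def j_def)
  have B: "ratfun.subspace ?B"
    using subspace_node_ring[of a b] f(1)
    by (simp add: ratfun.subspace_def mem_times_image_iff add_divide_distrib cscale_def
        flip: times_divide_eq_right)
  define l where "l h = coeff_at a (ord a f) h / coeff_at a (ord a f) f
    - coeff_at b (ord b f) h / coeff_at b (ord b f) f" for h
  let ?M = "ord_ge (1 + int i) a \<inter> ord_ge (1 + int j) b"
  have B_eq: "?B = {h \<in> ?M. l h = 0}"
    unfolding times_node_ring_nonunit[OF f(1)] by (auto simp: l_def o)
  have M: "?M \<subseteq> ord_ge 1 a" "?M \<subseteq> ord_ge 1 b"
    by (auto intro: ord_ge_mono[where m = "1 + int i"] ord_ge_mono[where m = "1 + int j"])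
  have B1: "?B \<subseteq> ?M" "?B \<subseteq> ord_ge (1 + int j) b \<inter> ord_ge 1 a"
    using M unfolding B_eq by blast+
  \<comment> \<open>Minimal order at \<open>a\<close> and one more than minimal at \<open>b\<close>:
    only the first term of \<open>l h\<close> survives.\<close>
  obtain h where h: "h \<noteq> 0" "ord a h = 1 + int i" "ord b h = 2 + int j"
    using prescribed_order_pair[OF ab] .
  have lh: "l h \<noteq> 0"
    using leading_nonzero[OF h(1), of a] leading_nonzero[OF f(1), of a] h ab
    by (simp add: l_def o expansion_nth_below)
  \<comment> \<open>All steps of the chain \<open>node_ring a b \<supset> ord_ge 1 a \<inter> ord_ge 1 b \<supset> \<dots> \<supset> ?M \<supset> ?B\<close> are one-dimensional.\<close>
  have "\<exists>S. quotient_basis ?M ?B S \<and> card S = 1"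
  proof -
    note * = quotient_basis_insert[of ?M h l ?B "{}"]
    have "quotient_basis ?M ?B {h}"
    proof (rule *)
      show "ratfun.subspace ?M"
        by (intro ratfun.subspace_inter subspace_ord_ge)
      show "h \<in> ?M"
        using h ab by (auto simp: ord_ge_iff)
      show "quotient_basis {h \<in> ?M. l h = 0} ?B {}"
        unfolding B_eq[symmetric] by (rule quotient_basis_refl[OF B])
      show "?B \<subseteq> {h \<in> ?M. l h = 0}"
        by (simp only: B_eq)
    qed (use lh in \<open>auto simp: l_def expansion_add expansion_cscale add_divide_distrib algebra_simps\<close>)
    then show ?thesis
      by (intro exI[of _ "{h}"]) auto
  qed
  then have "\<exists>S. quotient_basis (ord_ge 1 a \<inter> ord_ge (1 + int j) b) ?B S \<and> card S = i + 1"
  proof (intro quotient_basis_ord_ge_Int[OF B, where k = i])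
    show "\<exists>f\<in>ord_ge (1 + int j) b. f \<noteq> 0 \<and> ord a f = k" for k
    proof -
      obtain h where "h \<noteq> 0" "ord a h = k" "ord b h = 1 + int j"
        using prescribed_order_pair[OF ab] .
      then show ?thesis
        by (intro bexI[of _ h]) (auto simp: ord_ge_iff)
    qed
  qed (use B1 subspace_ord_ge in simp_all)
  then have "\<exists>S. quotient_basis (ord_ge 1 b \<inter> ord_ge 1 a) ?B S \<and> card S = j + (i + 1)"
  proof (intro quotient_basis_ord_ge_Int[OF B, where k = j])
    show "\<exists>f\<in>ord_ge 1 a. f \<noteq> 0 \<and> ord b f = k" for k
    proof -
      obtain h where "h \<noteq> 0" "ord a h = 1" "ord b h = k"
        using prescribed_order_pair[OF ab] .
      then show ?thesis
        by (intro bexI[of _ h]) (auto simp: ord_ge_iff)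
    qed
  qed (use B1 subspace_ord_ge in \<open>simp_all add: Int_commute\<close>)
  moreover have "ord_ge 1 q = {g \<in> ord_ge 0 q. coeff_at q 0 g = 0}" for q
    using ord_ge_Suc[of _ 0 q] by auto
  then have eq: "ord_ge 1 b \<inter> ord_ge 1 a = {g \<in> node_ring a b. coeff_at a 0 g = 0}"
    by (auto simp: node_ring_def)
  moreover have "?B \<subseteq> {g \<in> node_ring a b. coeff_at a 0 g = 0}"
    using B1 M unfolding eq[symmetric] by blast
  ultimately have "\<exists>S. quotient_basis (node_ring a b) ?B S \<and> card S = Suc (j + (i + 1))"
    by (intro quotient_basis_coeff_step[OF subspace_node_ring refl one_in_node_ring, where q = a and n = 0])
      simp_all
  then have "quotient_dim (node_ring a b) ?B = Suc (j + (i + 1))"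
    using quotient_dim_eqI[OF subspace_node_ring B] by blast
  then show ?thesis
    using o by simp
qed

section \<open>Stalks, orders and degrees on the curve\<close>

lemma node_iff: "node X x \<longleftrightarrow>
   (\<exists>a b. a \<noteq> b \<and> normalization X -` {x} = {a, b} \<and> stalk X x = node_ring a b)"
  by (auto simp: node_def node_ring_def local_ring_ord_ge value_at_def)

lemma point_cases:
  assumes "rational_nodal_curve X" "x \<in> points X"
  obtains (smooth) q where "\<not> node X x" "normalization X -` {x} = {q}" "stalk X x = ord_ge 0 q"
  | (node) a b where "node X x" "a \<noteq> b" "normalization X -` {x} = {a, b}" "stalk X x = node_ring a b"
proof (cases "node X x")
  case True
  then show ?thesis
    using node unfolding node_iff by blast
next
  case False
  then show ?thesis
    using assms smooth unfolding rational_nodal_curve_def smooth_point_def local_ring_ord_ge by blast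
qed

context
  fixes X :: "('x, 'z) curve_scheme" and x :: 'x
  assumes X: "rational_nodal_curve X" and x: "x \<in> points X"
begin

lemma finite_fibre: "finite (normalization X -` {x})"
  using X x by (cases rule: point_cases) auto

lemma subspace_stalk: "ratfun.subspace (stalk X x)"
  using X x by (cases rule: point_cases) (auto simp: subspace_ord_ge subspace_node_ring)

lemma one_in_stalk: "1 \<in> stalk X x"
  using X x by (cases rule: point_cases) (auto simp: one_in_node_ring ord_ge_iff)

lemma stalk_mult: "f \<in> stalk X x \<Longrightarrow> g \<in> stalk X x \<Longrightarrow> f * g \<in> stalk X x"
  using X x ord_ge_mult[of f 0 _ g 0]
  by (cases rule: point_cases) (auto simp: node_ring_mult)

lemma stalk_regular:
  assumes f: "f \<in> stalk X x" and q: "normalization X q = x"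
  shows "f \<in> ord_ge 0 q"
proof -
  have "q \<in> normalization X -` {x}"
    using q by simp
  with X x f show ?thesis
    by (cases rule: point_cases) (auto simp: node_ring_def)
qed

text \<open>At a node the hypothesis puts \<open>f\<close> into the conductor: vanishing on both
  branches forces equal values. Later membership proofs can thereby work with orders alone.\<close>

lemma stalkI:
  assumes "\<And>q. normalization X q = x \<Longrightarrow> f \<in> ord_ge (of_bool (node X x)) q"
  shows "f \<in> stalk X x"
  using X x
proof (cases rule: point_cases)
  case (smooth q)
  with assms[of q] show ?thesis
    by auto
next
  case (node a b)
  then have "f \<in> ord_ge 1 a" "f \<in> ord_ge 1 b"
    using assms[of a] assms[of b] by auto
  with node show ?thesis
    using ord_ge_Suc[of f 0] by (auto simp: node_ring_def)
qed

lemma ord_at_eq: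
  assumes "f \<noteq> 0" "f \<in> stalk X x"
  shows "int (ord_at X x f) = (\<Sum>q\<in>normalization X -` {x}. ord q f)"
  using X x
proof (cases rule: point_cases)
  case (smooth q)
  with assms show ?thesis
    by (simp add: ord_at_def quotient_dim_local_ring ord_ge_iff)
next
  case (node a b)
  moreover have "0 \<le> ord a f" "0 \<le> ord b f"
    using node assms by (auto simp: node_ring_def ord_ge_iff)
  ultimately show ?thesis
    using assms by (simp add: ord_at_def quotient_dim_node_ring)
qed

text \<open>The quotient of two generators of the same module lies in the local ring and so has no
  pole on any branch. With the roles exchanged this makes the order of a generator well
  defined.\<close>

lemma generates_ord_le:
  assumes "generates X F x \<psi>" "generates X F x \<psi>'" "normalization X q = x"
  shows "ord q \<psi> \<le> ord q \<psi>'"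
proof -
  have "\<psi>' \<in> (*) \<psi>' ` stalk X x"
    using one_in_stalk by force
  then have "\<psi>' \<in> (*) \<psi> ` stalk X x"
    using assms by (auto simp: generates_def)
  then have "\<psi>' / \<psi> \<in> stalk X x"
    using assms mem_times_image_iff[of \<psi> \<psi>' "stalk X x"] unfolding generates_def by blast
  then have "\<psi>' / \<psi> \<in> ord_ge 0 q"
    using assms(3) by (rule stalk_regular)
  then show ?thesis
    using assms(1,2) unfolding generates_def by (simp add: divide_ord_ge_iff) (simp add: ord_ge_iff)
qed

lemma generates_ord_eq:
  "generates X F x \<psi> \<Longrightarrow> generates X F x \<psi>' \<Longrightarrow> normalization X q = x \<Longrightarrow> ord q \<psi> = ord q \<psi>'"
  by (intro antisym generates_ord_le)

text \<open>The local degree is that of the pullback to the normalization; the sign appears because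
  O(D) is generated by the inverse of a local equation of D.\<close>

lemma local_degree_eq:
  assumes \<psi>: "generates X L x \<psi>"
  shows "local_degree X L x = - (\<Sum>q\<in>normalization X -` {x}. ord q \<psi>)"
  unfolding local_degree_def
proof (rule the_equality)
  have \<psi>0: "\<psi> \<noteq> 0"
    using \<psi> by (simp add: generates_def)
  have val: "int (ord_at X x a) - int (ord_at X x b) = - (\<Sum>q\<in>normalization X -` {x}. ord q \<psi>)"
    if "a \<in> stalk X x" "b \<in> stalk X x" "a \<noteq> 0" "b \<noteq> 0" "generates X L x (b / a)" for a b
  proof -
    have "ord q \<psi> = ord q b - ord q a" if "normalization X q = x" for q
      using generates_ord_eq[OF \<psi> \<open>generates X L x (b / a)\<close> that] \<open>a \<noteq> 0\<close> \<open>b \<noteq> 0\<close>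
      by (simp add: ord_divide)
    then have "(\<Sum>q\<in>normalization X -` {x}. ord q \<psi>) = (\<Sum>q\<in>normalization X -` {x}. ord q b - ord q a)"
      by (intro sum.cong) auto
    then show ?thesis
      using that by (simp add: ord_at_eq sum_subtractf)
  qed
  \<comment> \<open>A common denominator inside the conductor: \<open>h\<close> and
    \<open>h * \<psi>\<close> both vanish on every branch, hence belong to the stalk.\<close>
  obtain h where h: "h \<noteq> 0" "\<And>q. q \<in> normalization X -` {x} \<Longrightarrow> ord q h = max 1 (1 - ord q \<psi>)"
    by (rule prescribed_orders[OF finite_fibre, of "\<lambda>q. max 1 (1 - ord q \<psi>)"]) blast
  have "h \<in> stalk X x" "h * \<psi> \<in> stalk X x"
    using h \<psi>0 by (auto intro!: stalkI simp: ord_ge_iff ord_mult)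
  moreover have "generates X L x (h * \<psi> / h)"
    using h \<psi> by simp
  ultimately show "\<exists>a b. a \<in> stalk X x \<and> b \<in> stalk X x \<and> a \<noteq> 0 \<and> b \<noteq> 0 \<and> generates X L x (b / a) \<and>
      - (\<Sum>q\<in>normalization X -` {x}. ord q \<psi>) = int (ord_at X x a) - int (ord_at X x b)"
    using val[of h "h * \<psi>"] h \<psi>0 by (intro exI[of _ h] exI[of _ "h * \<psi>"]) auto
  fix d
  assume "\<exists>a b. a \<in> stalk X x \<and> b \<in> stalk X x \<and> a \<noteq> 0 \<and> b \<noteq> 0 \<and> generates X L x (b / a) \<and>
      d = int (ord_at X x a) - int (ord_at X x b)"
  then show "d = - (\<Sum>q\<in>normalization X -` {x}. ord q \<psi>)"
    using val by blast
qed

end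


section \<open>The dualizing sheaf\<close>

text \<open>The factor dt/ds is itself a rational function, 1 at finite points and - t^2 at
  infinity, so residues can be treated with orders of rational functions.\<close>

lemma deriv_coordinate_expansion:
  obtains u where "u \<noteq> 0" "ord q u = - kappa q" "fls_deriv (coordinate_at q) = expansion q u"
proof (cases q)
  case None
  have eq: "expansion q (- to_fract [:0, 0, 1:]) = fls_deriv (coordinate_at q)"
    using None by (simp add: expansion_uminus expansion_to_fract coordinate_at_def power2_eq_square)
  show thesis
  proof (rule that)
    show "ord q (- to_fract [:0, 0, 1:]) = - kappa q"
      unfolding ord_def eq by simp
  qed (simp_all only: eq, simp)
next
  case (Some a)
  then show thesis
    using that[of 1] by (simp add: coordinate_at_def kappa_def)
qed

lemma diff_residue_eq_0:
  assumes "h \<in> ord_ge (kappa q) q"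
  shows "diff_residue q h = 0"
proof -
  obtain u where u: "u \<noteq> 0" "ord q u = - kappa q" "fls_deriv (coordinate_at q) = expansion q u"
    by (rule deriv_coordinate_expansion)
  then have "h * u \<in> ord_ge 0 q"
    using assms ord_ge_mult[of h "kappa q" q u "- kappa q"] by (simp add: ord_ge_iff)
  then show ?thesis
    using u by (auto simp: diff_residue_def ord_ge_def simp flip: expansion_mult)
qed

lemma diff_residue_nonzero:
  assumes "h \<noteq> 0" "ord q h = kappa q - 1"
  shows "diff_residue q h \<noteq> 0"
proof -
  obtain u where u: "u \<noteq> 0" "ord q u = - kappa q" "fls_deriv (coordinate_at q) = expansion q u"
    by (rule deriv_coordinate_expansion)
  then have "h * u \<noteq> 0" "ord q (h * u) = - 1"
    using assms by (simp_all add: ord_mult)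
  then show ?thesis
    using u leading_nonzero[of "h * u" q] by (simp add: diff_residue_def expansion_mult)
qed

text \<open>If h dt has at most a simple pole, only the value of \<open>f\<close> enters the
  residue. This is how residues detect the gluing condition at a node.\<close>

lemma diff_residue_mult:
  assumes f: "f \<in> ord_ge 0 q" and h: "h \<in> ord_ge (kappa q - 1) q"
  shows "diff_residue q (f * h) = coeff_at q 0 f * diff_residue q h"
proof -
  obtain u where u: "u \<noteq> 0" "ord q u = - kappa q" "fls_deriv (coordinate_at q) = expansion q u"
    by (rule deriv_coordinate_expansion)
  then have "h * u \<in> ord_ge (- 1) q"
    using h ord_ge_mult[of h "kappa q - 1" q u "- kappa q"] by (simp add: ord_ge_iff)
  then show ?thesis
    using u expansion_nth_mult[OF f, of "h * u" "- 1"]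
    by (simp add: diff_residue_def expansion_mult mult.assoc)
qed

lemma diff_residue_diff: "diff_residue q (f - g) = diff_residue q f - diff_residue q g"
  by (simp add: diff_residue_def expansion_diff left_diff_distrib)

lemma diff_residue_cscale: "diff_residue q (cscale c f) = c * diff_residue q f"
  by (simp add: diff_residue_def expansion_cscale mult.assoc)

lemma dualizing_sheaf_smooth:
  assumes q: "normalization X -` {x} = {q}" and s: "stalk X x = ord_ge 0 q"
  shows "dualizing_sheaf X x = ord_ge (kappa q) q"
proof (intro equalityI subsetI)
  fix h
  assume "h \<in> ord_ge (kappa q) q"
  then have "f * h \<in> ord_ge (kappa q) q" if "f \<in> ord_ge 0 q" for f
    using ord_ge_mult[OF that] by force
  then show "h \<in> dualizing_sheaf X x"
    by (simp add: dualizing_sheaf_def q s diff_residue_eq_0)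
next
  fix h
  assume h: "h \<in> dualizing_sheaf X x"
  show "h \<in> ord_ge (kappa q) q"
  proof (rule ccontr)
    assume "h \<notin> ord_ge (kappa q) q"
    then have less: "h \<noteq> 0" "ord q h < kappa q"
      by (auto simp: ord_ge_iff)
    \<comment> \<open>Multiplication by \<open>f\<close> reduces the pole of h dt to a simple one,
      whose residue cannot vanish.\<close>
    obtain f where f: "f \<noteq> 0" "ord q f = kappa q - 1 - ord q h"
      by (rule prescribed_order)
    then have "f \<in> stalk X x"
      using less by (simp add: s ord_ge_iff)
    moreover have "diff_residue q (f * h) \<noteq> 0"
      using f less by (intro diff_residue_nonzero) (simp_all add: ord_mult)
    ultimately show False
      using h by (auto simp: dualizing_sheaf_def q)
  qed
qed

lemma dualizing_sheaf_node:
  assumes ab: "a \<noteq> b" and q: "normalization X -` {x} = {a, b}" and s: "stalk X x = node_ring a b"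
  shows "dualizing_sheaf X x = {h \<in> ord_ge (kappa a - 1) a \<inter> ord_ge (kappa b - 1) b.
    diff_residue a h + diff_residue b h = 0}" (is "_ = ?R")
proof (intro equalityI subsetI)
  fix h
  assume h: "h \<in> ?R"
  have "diff_residue a (f * h) + diff_residue b (f * h) = 0" if f: "f \<in> node_ring a b" for f
  proof -
    have "diff_residue a (f * h) + diff_residue b (f * h) =
        coeff_at a 0 f * diff_residue a h + coeff_at b 0 f * diff_residue b h"
      using f h by (simp add: node_ring_def diff_residue_mult)
    also have "\<dots> = coeff_at a 0 f * (diff_residue a h + diff_residue b h)"
      using f by (simp add: node_ring_def distrib_left)
    also have "\<dots> = 0"
      using h by simp
    finally show ?thesis .
  qed
  then show "h \<in> dualizing_sheaf X x"
    using ab by (simp add: dualizing_sheaf_def q s)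
next
  fix h
  assume "h \<in> dualizing_sheaf X x"
  then have h: "diff_residue a (f * h) + diff_residue b (f * h) = 0" if "f \<in> node_ring a b" for f
    using that ab by (simp add: dualizing_sheaf_def q s)
  \<comment> \<open>Stated for an ordered pair so that one argument serves both branches.\<close>
  have *: "h \<in> ord_ge (kappa c - 1) c" if c: "c \<noteq> d" "{c, d} = {a, b}" for c d
  proof (rule ccontr)
    assume "h \<notin> ord_ge (kappa c - 1) c"
    then have less: "h \<noteq> 0" "ord c h < kappa c - 1"
      by (auto simp: ord_ge_iff)
    \<comment> \<open>On the branch \<open>c\<close> exactly a simple pole of f h dt is left, on
      \<open>d\<close> none; both orders of \<open>f\<close> are positive, which puts
      \<open>f\<close> into the conductor.\<close>
    obtain f where f: "f \<noteq> 0" "ord c f = kappa c - 1 - ord c h" "ord d f = max 1 (kappa d - ord d h)"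
      by (rule prescribed_order_pair[OF c(1)])
    have "f \<in> ord_ge 1 c" "f \<in> ord_ge 1 d"
      using f less by (auto simp: ord_ge_iff)
    then have "f \<in> ord_ge 1 a" "f \<in> ord_ge 1 b"
      using c by (auto simp: doubleton_eq_iff)
    then have "f \<in> node_ring a b"
      using ord_ge_Suc[of f 0] by (simp add: node_ring_def)
    then have "diff_residue c (f * h) + diff_residue d (f * h) = 0"
      using h[of f] c by (auto simp: doubleton_eq_iff add.commute)
    moreover have "diff_residue c (f * h) \<noteq> 0"
      using f less by (intro diff_residue_nonzero) (simp_all add: ord_mult)
    moreover have "diff_residue d (f * h) = 0"
      using f less by (intro diff_residue_eq_0) (simp add: ord_ge_iff ord_mult)
    ultimately show False
      by simp
  qed
  show "h \<in> ?R"
    using *[of a b] *[of b a] ab h[of 1] one_in_node_ring[of a b] by auto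
qed

lemma dualizing_generator_smooth:
  assumes "normalization X -` {x} = {q}" "stalk X x = ord_ge 0 q" "\<tau> \<noteq> 0" "ord q \<tau> = kappa q"
  shows "generates X (dualizing_sheaf X) x \<tau>"
  unfolding generates_def dualizing_sheaf_smooth[OF assms(1,2)] assms(2)
  using assms(3,4) by (simp add: Set.set_eq_iff mem_times_image_iff divide_ord_ge_iff)

text \<open>The residue of h dt on a branch is the value of \<open>h / \<tau>\<close> times the
  residue of \<tau> dt. As the latter are opposite and nonzero, cancelling residues of h dt mean
  equal values of \<open>h / \<tau>\<close>.\<close>

lemma dualizing_generator_node:
  assumes ab: "a \<noteq> b" and q: "normalization X -` {x} = {a, b}" and s: "stalk X x = node_ring a b"
    and \<tau>: "\<tau> \<noteq> 0" "ord a \<tau> = kappa a - 1" "ord b \<tau> = kappa b - 1"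
    and res: "diff_residue a \<tau> + diff_residue b \<tau> = 0"
  shows "generates X (dualizing_sheaf X) x \<tau>"
proof -
  have "h \<in> dualizing_sheaf X x \<longleftrightarrow> h / \<tau> \<in> node_ring a b" for h
  proof -
    have r: "diff_residue c h = coeff_at c 0 (h / \<tau>) * diff_residue c \<tau>"
      if "h / \<tau> \<in> ord_ge 0 c" "ord c \<tau> = kappa c - 1" for c
      using that \<tau>(1) diff_residue_mult[of "h / \<tau>" c \<tau>] by (simp add: ord_ge_iff[of \<tau>])
    have nz: "diff_residue a \<tau> \<noteq> 0" and eq: "diff_residue b \<tau> = - diff_residue a \<tau>"
      using diff_residue_nonzero[OF \<tau>(1,2)] res by (simp_all add: eq_neg_iff_add_eq_0 add.commute)
    have "h / \<tau> \<in> ord_ge 0 a \<longleftrightarrow> h \<in> ord_ge (kappa a - 1) a"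
      "h / \<tau> \<in> ord_ge 0 b \<longleftrightarrow> h \<in> ord_ge (kappa b - 1) b"
      using \<tau> by (simp_all add: divide_ord_ge_iff)
    then show ?thesis
      using r[of a] r[of b] \<tau> nz
      by (auto simp: dualizing_sheaf_node[OF ab q s] node_ring_def eq)
  qed
  then show ?thesis
    using \<tau> by (simp add: generates_def s Set.set_eq_iff mem_times_image_iff)
qed

lemma dualizing_generator_exists:
  assumes X: "rational_nodal_curve X" and x: "x \<in> points X"
  obtains \<tau> where "generates X (dualizing_sheaf X) x \<tau>"
    "\<And>q. normalization X q = x \<Longrightarrow> ord q \<tau> = kappa q - of_bool (node X x)"
  using X x
proof (cases rule: point_cases)
  case (smooth q)
  obtain \<tau> where \<tau>: "\<tau> \<noteq> 0" "ord q \<tau> = kappa q"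
    by (rule prescribed_order)
  have "ord q' \<tau> = kappa q' - of_bool (node X x)" if "normalization X q' = x" for q'
  proof -
    have "q' \<in> normalization X -` {x}"
      using that by simp
    then show ?thesis
      using smooth \<tau> by simp
  qed
  with dualizing_generator_smooth[OF smooth(2,3) \<tau>] show thesis
    by (rule that)
next
  case (node a b)
  obtain \<tau>\<^sub>1 where \<tau>1: "\<tau>\<^sub>1 \<noteq> 0" "ord a \<tau>\<^sub>1 = kappa a - 1" "ord b \<tau>\<^sub>1 = kappa b"
    by (rule prescribed_order_pair[OF node(2)])
  obtain \<tau>\<^sub>2 where \<tau>2: "\<tau>\<^sub>2 \<noteq> 0" "ord a \<tau>\<^sub>2 = kappa a" "ord b \<tau>\<^sub>2 = kappa b - 1"
    by (rule prescribed_order_pair[OF node(2)])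
  \<comment> \<open>Each summand has a pole on one of the two branches only; scaling makes the
    residues 1 and -1.\<close>
  define \<tau> where "\<tau> = cscale (1 / diff_residue a \<tau>\<^sub>1) \<tau>\<^sub>1 - cscale (1 / diff_residue b \<tau>\<^sub>2) \<tau>\<^sub>2"
  have "diff_residue a \<tau>\<^sub>1 \<noteq> 0" "diff_residue b \<tau>\<^sub>2 \<noteq> 0" "diff_residue b \<tau>\<^sub>1 = 0" "diff_residue a \<tau>\<^sub>2 = 0"
    using \<tau>1 \<tau>2 by (simp_all add: diff_residue_nonzero diff_residue_eq_0 ord_ge_iff)
  then have res: "diff_residue a \<tau> = 1" "diff_residue b \<tau> = - 1"
    by (simp_all add: \<tau>_def diff_residue_diff diff_residue_cscale)
  have ge: "\<tau> \<in> ord_ge (kappa a - 1) a" "\<tau> \<in> ord_ge (kappa b - 1) b"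
    unfolding \<tau>_def using \<tau>1 \<tau>2 by (intro ord_ge_diff ord_ge_cscale; simp add: ord_ge_iff)+
  have "\<tau> \<noteq> 0"
    using res by (auto simp: diff_residue_def)
  moreover have "\<not> kappa a \<le> ord a \<tau>" "\<not> kappa b \<le> ord b \<tau>"
    using res diff_residue_eq_0[of \<tau> a] diff_residue_eq_0[of \<tau> b] by (auto simp: ord_ge_iff)
  ultimately have \<tau>: "\<tau> \<noteq> 0" "ord a \<tau> = kappa a - 1" "ord b \<tau> = kappa b - 1"
    using ge by (auto simp: ord_ge_iff)
  have "ord q' \<tau> = kappa q' - of_bool (node X x)" if "normalization X q' = x" for q'
  proof -
    have "q' \<in> normalization X -` {x}"
      using that by simp
    then show ?thesis
      using node \<tau> by auto
  qed
  moreover have "generates X (dualizing_sheaf X) x \<tau>"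
    using dualizing_generator_node[OF node(2-4) \<tau>] res by simp
  ultimately show thesis
    using that by blast
qed

text \<open>Every generator shares the orders of the one constructed above. The drop by 1 over a
  node is the source of the node weights.\<close>

lemma dualizing_generator_ord:
  assumes "rational_nodal_curve X" "x \<in> points X"
    and "generates X (dualizing_sheaf X) x \<tau>" "normalization X q = x"
  shows "ord q \<tau> = kappa q - of_bool (node X x)"
proof -
  obtain \<tau>' where "generates X (dualizing_sheaf X) x \<tau>'" "ord q \<tau>' = kappa q - of_bool (node X x)"
    using dualizing_generator_exists[OF assms(1,2)] assms(4) by metis
  then show ?thesis
    using generates_ord_eq assms by metis
qed


section \<open>Wronskians\<close>

definition wronskian :: "nat \<Rightarrow> (nat \<Rightarrow> ratfun) \<Rightarrow> ratfun" where
  "wronskian n \<phi> = Determinant.det (mat n n (\<lambda>(i, j). (fract_deriv ^^ i) (\<phi> j)))"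

text \<open>Each row step differentiates and divides by \<open>\<tau>\<close>, so the order of the
  differential operator grows by one. Only its top coefficient has to be known: it becomes the
  diagonal of a row transformation.\<close>

lemma wronskian_entry_expand:
  "\<exists>A. (\<forall>f. wronskian_entry \<psi> \<tau> i f = (\<Sum>k\<le>i. A k * (fract_deriv ^^ k) f)) \<and>
    A i = inverse \<psi> * inverse \<tau> ^ i"
proof (induction i)
  case 0
  show ?case
    by (rule exI[of _ "\<lambda>_. inverse \<psi>"]) (simp add: divide_inverse mult.commute)
next
  case (Suc i)
  then obtain A where A: "\<And>f. wronskian_entry \<psi> \<tau> i f = (\<Sum>k\<le>i. A k * (fract_deriv ^^ k) f)"
    "A i = inverse \<psi> * inverse \<tau> ^ i"
    by blast
  \<comment> \<open>The two halves of the product rule: \<open>B\<close> differentiates the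
    coefficients, \<open>C\<close> shifts them because the derivative falls on the function.\<close>
  define B where "B k = (if k \<le> i then fract_deriv (A k) else 0)" for k
  define C where "C k = (case k of 0 \<Rightarrow> 0 | Suc k \<Rightarrow> A k)" for k
  have "wronskian_entry \<psi> \<tau> (Suc i) f = (\<Sum>k\<le>Suc i. (B k + C k) / \<tau> * (fract_deriv ^^ k) f)" for f
  proof -
    have "(\<Sum>k\<le>Suc i. B k * (fract_deriv ^^ k) f) = (\<Sum>k\<le>i. fract_deriv (A k) * (fract_deriv ^^ k) f)"
      by (simp add: B_def)
    moreover have "(\<Sum>k\<le>Suc i. C k * (fract_deriv ^^ k) f) = (\<Sum>k\<le>i. A k * (fract_deriv ^^ Suc k) f)"
      by (subst sum.atMost_Suc_shift) (simp add: C_def)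
    ultimately have "(\<Sum>k\<le>Suc i. (B k + C k) * (fract_deriv ^^ k) f) =
        fract_deriv (\<Sum>k\<le>i. A k * (fract_deriv ^^ k) f)"
      by (simp only: distrib_right sum.distrib fract_deriv_sum fract_deriv_mult funpow.simps o_apply)
    then have "wronskian_entry \<psi> \<tau> (Suc i) f = (\<Sum>k\<le>Suc i. (B k + C k) * (fract_deriv ^^ k) f) / \<tau>"
      by (simp only: wronskian_entry.simps A)
    also have "\<dots> = (\<Sum>k\<le>Suc i. (B k + C k) / \<tau> * (fract_deriv ^^ k) f)"
      by (simp only: sum_divide_distrib times_divide_eq_left)
    finally show ?thesis .
  qed
  moreover have "(B (Suc i) + C (Suc i)) / \<tau> = inverse \<psi> * inverse \<tau> ^ Suc i"
    by (simp add: B_def C_def A divide_inverse)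
  ultimately show ?case
    by (intro exI[of _ "\<lambda>k. (B k + C k) / \<tau>"]) blast
qed

text \<open>The expansions of the rows form a lower triangular matrix, so only its diagonal enters
  the determinant.\<close>

lemma det_wronskian_entry:
  "Determinant.det (mat n n (\<lambda>(i, j). wronskian_entry \<psi> \<tau> i (\<phi> j))) =
    (\<Prod>i<n. inverse \<psi> * inverse \<tau> ^ i) * wronskian n \<phi>"
proof -
  obtain A where A: "\<And>i f. wronskian_entry \<psi> \<tau> i f = (\<Sum>k\<le>i. A i k * (fract_deriv ^^ k) f)"
    "\<And>i. A i i = inverse \<psi> * inverse \<tau> ^ i"
    using wronskian_entry_expand[of \<psi> \<tau>] by metis
  define M where "M = mat n n (\<lambda>(i, k). if k \<le> i then A i k else 0)"
  define W where "W = mat n n (\<lambda>(i, j). (fract_deriv ^^ i) (\<phi> j))"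
  have carr: "M \<in> carrier_mat n n" "W \<in> carrier_mat n n"
    by (simp_all add: M_def W_def)
  have "mat n n (\<lambda>(i, j). wronskian_entry \<psi> \<tau> i (\<phi> j)) = M * W"
  proof (rule eq_matI)
    fix i j
    assume "i < dim_row (M * W)" "j < dim_col (M * W)"
    then have ij: "i < n" "j < n"
      using carr by auto
    have "(M * W) $$ (i, j) = (\<Sum>k = 0..<n. (if k \<le> i then A i k else 0) * (fract_deriv ^^ k) (\<phi> j))"
      using ij by (simp add: M_def W_def scalar_prod_def)
    also have "\<dots> = (\<Sum>k\<le>i. A i k * (fract_deriv ^^ k) (\<phi> j))"
      using ij by (intro sum.mono_neutral_cong_right) auto
    finally show "mat n n (\<lambda>(i, j). wronskian_entry \<psi> \<tau> i (\<phi> j)) $$ (i, j) = (M * W) $$ (i, j)"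
      using ij by (simp add: A)
  qed (use carr in auto)
  then have "Determinant.det (mat n n (\<lambda>(i, j). wronskian_entry \<psi> \<tau> i (\<phi> j))) =
      Determinant.det M * Determinant.det W"
    using det_mult[OF carr] by simp
  also have "Determinant.det M = (\<Prod>i<n. inverse \<psi> * inverse \<tau> ^ i)"
    using carr
    by (subst det_lower_triangular[of n])
      (auto simp: M_def prod_list_diag_prod A atLeast0LessThan)
  finally show ?thesis
    by (simp add: wronskian_def W_def)
qed

lemma ord_det_wronskian_entry:
  assumes "\<psi> \<noteq> 0" "\<tau> \<noteq> 0" "wronskian n \<phi> \<noteq> 0"
  shows "Determinant.det (mat n n (\<lambda>(i, j). wronskian_entry \<psi> \<tau> i (\<phi> j))) \<noteq> 0"
    and "ord q (Determinant.det (mat n n (\<lambda>(i, j). wronskian_entry \<psi> \<tau> i (\<phi> j)))) =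
      ord q (wronskian n \<phi>) - int n * ord q \<psi> - (\<Sum>i<n. int i) * ord q \<tau>"
proof -
  have "ord q (\<Prod>i<n. inverse \<psi> * inverse \<tau> ^ i) = (\<Sum>i<n. - ord q \<psi> - int i * ord q \<tau>)"
    using assms by (subst ord_prod) (simp_all add: ord_mult ord_power)
  also have "\<dots> = - int n * ord q \<psi> - (\<Sum>i<n. int i) * ord q \<tau>"
    by (simp add: sum_subtractf sum_distrib_right)
  finally show "ord q (Determinant.det (mat n n (\<lambda>(i, j). wronskian_entry \<psi> \<tau> i (\<phi> j)))) =
      ord q (wronskian n \<phi>) - int n * ord q \<psi> - (\<Sum>i<n. int i) * ord q \<tau>"
    using assms by (simp add: det_wronskian_entry ord_mult)
  show "Determinant.det (mat n n (\<lambda>(i, j). wronskian_entry \<psi> \<tau> i (\<phi> j))) \<noteq> 0"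
    using assms by (simp add: det_wronskian_entry)
qed

lemma wronskian_kernel:
  assumes W: "wronskian n \<phi> \<noteq> 0"
    and u: "\<And>i. i < n \<Longrightarrow> (\<Sum>j<n. (fract_deriv ^^ i) (\<phi> j) * u j) = 0" and "j < n"
  shows "u j = 0"
proof -
  define M where "M = mat n n (\<lambda>(i, j). (fract_deriv ^^ i) (\<phi> j))"
  have M: "M \<in> carrier_mat n n"
    by (simp add: M_def)
  have "M *\<^sub>v vec n u = 0\<^sub>v n"
    using u by (intro eq_vecI) (auto simp: M_def scalar_prod_def atLeast0LessThan)
  then have "vec n u = 0\<^sub>v n"
    using W det_0_iff_vec_prod_zero[OF M] vec_carrier[of n u] unfolding wronskian_def M_def by blast
  then show ?thesis
    using \<open>j < n\<close> by (metis index_vec index_zero_vec(1))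
qed

text \<open>Independence is over the constants, while a vanishing determinant gives a relation over
  the whole function field. The induction hypothesis makes the last coefficient of such a relation
  nonzero, so that it can be scaled to 1.\<close>

lemma wronskian_nonzero:
  assumes "\<And>c j. (\<Sum>j<n. cscale (c j) (\<phi> j)) = 0 \<Longrightarrow> j < n \<Longrightarrow> c j = 0"
  shows "wronskian n \<phi> \<noteq> 0"
  using assms
proof (induction n)
  case 0
  have "mat 0 0 (\<lambda>(i, j). (fract_deriv ^^ i) (\<phi> j)) \<in> carrier_mat 0 0"
    by simp
  then show ?case
    by (simp add: wronskian_def det_dim_zero)
next
  case (Suc n)
  have W: "wronskian n \<phi> \<noteq> 0"
  proof (rule Suc.IH)
    fix c j
    assume c: "(\<Sum>j<n. cscale (c j) (\<phi> j)) = 0" and j: "j < n"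
    then have "(\<Sum>j<Suc n. cscale ((c(n := 0)) j) (\<phi> j)) = 0"
      by simp
    then have "(c(n := 0)) j = 0"
      using Suc.prems j less_SucI by blast
    then show "c j = 0"
      using j by simp
  qed
  show ?case
  proof
    define M where "M = mat (Suc n) (Suc n) (\<lambda>(i, j). (fract_deriv ^^ i) (\<phi> j))"
    have M: "M \<in> carrier_mat (Suc n) (Suc n)"
      by (simp add: M_def)
    assume "wronskian (Suc n) \<phi> = 0"
    then obtain v where v: "v \<in> carrier_vec (Suc n)" "v \<noteq> 0\<^sub>v (Suc n)" "M *\<^sub>v v = 0\<^sub>v (Suc n)"
      using det_0_iff_vec_prod_zero[OF M] unfolding wronskian_def M_def by blast
    have ker: "(\<Sum>j<Suc n. (fract_deriv ^^ i) (\<phi> j) * v $ j) = 0" if "i < Suc n" for i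
    proof -
      have "(M *\<^sub>v v) $ i = (\<Sum>j<Suc n. (fract_deriv ^^ i) (\<phi> j) * v $ j)"
        using that v(1) by (simp add: M_def scalar_prod_def atLeast0LessThan)
      then show ?thesis
        using that v(3) by simp
    qed
    have vn: "v $ n \<noteq> 0"
    proof
      assume 0: "v $ n = 0"
      then have "v $ j = 0" if "j < n" for j
        using wronskian_kernel[OF W, of "\<lambda>j. v $ j" j] ker that by simp
      with 0 have "v = 0\<^sub>v (Suc n)"
        using v(1) by (intro eq_vecI) (auto simp: less_Suc_eq)
      with v show False
        by simp
    qed
    \<comment> \<open>Differentiating the relations between the columns, normalized by \<open>w n = 1\<close>, shows that
      their coefficients are constants.\<close>
    define w where "w j = v $ j / v $ n" for j
    have kerw: "(\<Sum>j<Suc n. (fract_deriv ^^ i) (\<phi> j) * w j) = 0" if "i < Suc n" for i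
      using ker[OF that] vn
      by (simp add: w_def add_divide_distrib[symmetric] sum_divide_distrib[symmetric])
    have "fract_deriv (w j) = 0" if "j < n" for j
    proof (rule wronskian_kernel[OF W _ that])
      fix i
      assume i: "i < n"
      have "0 = fract_deriv (\<Sum>j<Suc n. (fract_deriv ^^ i) (\<phi> j) * w j)"
        using kerw[of i] i by simp
      also have "\<dots> = (\<Sum>j<Suc n. (fract_deriv ^^ Suc i) (\<phi> j) * w j)
          + (\<Sum>j<Suc n. (fract_deriv ^^ i) (\<phi> j) * fract_deriv (w j))"
        by (simp only: fract_deriv_sum fract_deriv_mult sum.distrib funpow.simps o_apply)
      also have "\<dots> = (\<Sum>j<n. (fract_deriv ^^ i) (\<phi> j) * fract_deriv (w j))"
        using kerw[of "Suc i"] i vn by (simp add: w_def del: funpow.simps)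
      finally show "(\<Sum>j<n. (fract_deriv ^^ i) (\<phi> j) * fract_deriv (w j)) = 0"
        by simp
    qed
    moreover have "fract_deriv (w n) = 0"
      using vn by (simp add: w_def)
    ultimately have "\<exists>c. w j = const_fun c" if "j < Suc n" for j
      using that fract_deriv_eq_0D[of "w j"] by (metis less_SucE)
    then obtain c where c: "\<And>j. j < Suc n \<Longrightarrow> w j = const_fun (c j)"
      by metis
    have "(\<Sum>j<Suc n. cscale (c j) (\<phi> j)) = (\<Sum>j<Suc n. (fract_deriv ^^ 0) (\<phi> j) * w j)"
      by (intro sum.cong) (simp_all add: cscale_def c)
    then have "c n = 0"
      using kerw[of 0] Suc.prems[of c n] by simp
    then have "w n = 0"
      using c[of n] by simp
    then show False
      using vn by (simp add: w_def)
  qed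
qed

section \<open>Orders of Wronskians: lower bounds and change of basis\<close>

lemma det_ord_ge:
  assumes "\<And>i j. i < n \<Longrightarrow> j < n \<Longrightarrow> f i j \<in> ord_ge 0 q"
  shows "Determinant.det (mat n n (\<lambda>(i, j). f i j)) \<in> ord_ge 0 q"
proof -
  have sum: "(\<Sum>i\<in>I. g i) \<in> ord_ge 0 q" if "\<And>i. i \<in> I \<Longrightarrow> g i \<in> ord_ge 0 q" for I and g :: "'i \<Rightarrow> ratfun"
    using that by (rule ratfun.subspace_sum[OF subspace_ord_ge])
  have prod: "(\<Prod>i\<in>I. g i) \<in> ord_ge 0 q" if "\<And>i. i \<in> I \<Longrightarrow> g i \<in> ord_ge 0 q" for I and g :: "'i \<Rightarrow> ratfun"
    using that
  proof (induction I rule: infinite_finite_induct)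
    case (insert i I)
    then show ?case
      using ord_ge_mult[of "g i" 0 q "prod g I" 0] by simp
  qed (simp_all add: ord_ge_iff)
  have perm: "p i < n" if "p permutes {0..<n}" "i < n" for p i
    using permutes_in_image[OF that(1), of i] that(2) by simp
  have one: "1 \<in> ord_ge 0 q"
    by (simp add: ord_ge_iff)
  then have sign: "signof p \<in> ord_ge 0 q" for p
    using ord_ge_uminus[OF one] by (simp add: sign_def)
  show ?thesis
    unfolding det_def'[OF mat_carrier]
  proof (rule sum)
    fix p
    assume "p \<in> {p. p permutes {0..<n}}"
    then have "(\<Prod>i = 0..<n. mat n n (\<lambda>(i, j). f i j) $$ (i, p i)) \<in> ord_ge 0 q"
      using assms perm by (intro prod) auto
    then show "signof p * (\<Prod>i = 0..<n. mat n n (\<lambda>(i, j). f i j) $$ (i, p i)) \<in> ord_ge 0 q"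
      using ord_ge_mult[OF sign] by (metis add_0)
  qed
qed

text \<open>In the local parameter s the derivative of a power series is a power series; the factor
  dt/ds contributes the shift by \<open>kappa q\<close>.\<close>

lemma fract_deriv_ord_ge:
  assumes g: "g \<in> ord_ge 0 q"
  shows "fract_deriv g \<in> ord_ge (kappa q) q"
proof -
  obtain u where u: "u \<noteq> 0" "ord q u = - kappa q" "fls_deriv (coordinate_at q) = expansion q u"
    by (rule deriv_coordinate_expansion)
  have "expansion q (fract_deriv g * u) = fls_deriv (expansion q g)"
    using expansion_fract_deriv[of q g] u by (simp add: expansion_mult)
  \<comment> \<open>At \<open>k = - 1\<close> the constant term is differentiated and the factor
    \<open>k + 1\<close> vanishes.\<close>
  moreover have "fls_nth (fls_deriv (expansion q g)) k = 0" if "k < 0" for k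
    using that g by (cases "k = - 1") (simp_all add: ord_ge_def)
  ultimately have "fract_deriv g * u \<in> ord_ge 0 q"
    by (simp add: ord_ge_def)
  then have "fract_deriv g / inverse u \<in> ord_ge 0 q"
    by (simp add: divide_inverse)
  then show ?thesis
    using u by (subst (asm) divide_ord_ge_iff) simp_all
qed

lemma wronskian_entry_regular:
  assumes "\<psi> \<noteq> 0" "f \<in> ord_ge (ord q \<psi>) q" "\<tau> \<noteq> 0" "ord q \<tau> = kappa q"
  shows "wronskian_entry \<psi> \<tau> i f \<in> ord_ge 0 q"
  using assms by (induction i) (simp_all add: divide_ord_ge_iff fract_deriv_ord_ge)

text \<open>The matrix of \<open>wronskian_entry\<close> is reused with generators adapted to the
  projective line instead of the curve: here \<tau> dt generates the ordinary differentials at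
  \<open>q\<close>. The determinant is regular, and removing the factors from \<open>\<psi>\<close>
  and \<open>\<tau>\<close> gives the bound, which later says that \<epsilon> is
  nonnegative.\<close>

lemma wronskian_ord_ge:
  assumes W: "wronskian n \<phi> \<noteq> 0" and \<phi>: "\<And>j. j < n \<Longrightarrow> \<phi> j \<in> ord_ge e q"
  shows "int n * e + (\<Sum>i<n. int i) * kappa q \<le> ord q (wronskian n \<phi>)"
proof -
  obtain \<psi> where \<psi>: "\<psi> \<noteq> 0" "ord q \<psi> = e"
    by (rule prescribed_order)
  obtain \<tau> where \<tau>: "\<tau> \<noteq> 0" "ord q \<tau> = kappa q"
    by (rule prescribed_order)
  have "Determinant.det (mat n n (\<lambda>(i, j). wronskian_entry \<psi> \<tau> i (\<phi> j))) \<in> ord_ge 0 q"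
    using \<phi> \<psi> \<tau> by (intro det_ord_ge wronskian_entry_regular) simp_all
  then show ?thesis
    using ord_det_wronskian_entry[OF \<psi>(1) \<tau>(1) W] \<psi> \<tau> by (simp add: ord_ge_iff)
qed

text \<open>Passing from \<open>\<phi>\<close> to \<open>\<phi>'\<close> multiplies the Wronskian by
  a determinant of constants, which has no pole. Applied in both directions, this makes the order
  independent of the basis.\<close>

lemma wronskian_ord_le:
  assumes W: "wronskian n \<phi>' \<noteq> 0" and span: "\<And>j. j < n \<Longrightarrow> \<phi>' j \<in> ratfun.span (\<phi> ` {..<n})"
    and inj: "inj_on \<phi> {..<n}"
  shows "wronskian n \<phi> \<noteq> 0" and "ord q (wronskian n \<phi>) \<le> ord q (wronskian n \<phi>')"
proof -
  have "\<forall>j\<in>{..<n}. \<exists>c. \<phi>' j = (\<Sum>k<n. cscale (c k) (\<phi> k))"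
  proof
    fix j
    assume "j \<in> {..<n}"
    then obtain c where "\<phi>' j = (\<Sum>v\<in>\<phi> ` {..<n}. cscale (c v) v)"
      using span[of j] by (auto simp: ratfun.span_finite)
    then show "\<exists>c. \<phi>' j = (\<Sum>k<n. cscale (c k) (\<phi> k))"
      by (auto simp: sum.reindex[OF inj])
  qed
  then obtain c where c: "\<And>j. j < n \<Longrightarrow> \<phi>' j = (\<Sum>k<n. cscale (c j k) (\<phi> k))"
    unfolding bchoice_iff by auto
  have D: "(fract_deriv ^^ i) (\<Sum>k<n. cscale (c j k) (\<phi> k)) =
      (\<Sum>k<n. cscale (c j k) ((fract_deriv ^^ i) (\<phi> k)))" for i j
    by (induction i) (simp_all add: fract_deriv_sum fract_deriv_cscale)
  then have D': "(fract_deriv ^^ i) (\<phi>' j) = (\<Sum>k<n. (fract_deriv ^^ i) (\<phi> k) * const_fun (c j k))"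
    if "j < n" for i j
    using c[OF that] by (simp add: cscale_def mult.commute)
  define M where "M = mat n n (\<lambda>(k, j). const_fun (c j k))"
  define V where "V = mat n n (\<lambda>(i, j). (fract_deriv ^^ i) (\<phi> j))"
  have carr: "M \<in> carrier_mat n n" "V \<in> carrier_mat n n"
    by (simp_all add: M_def V_def)
  have "mat n n (\<lambda>(i, j). (fract_deriv ^^ i) (\<phi>' j)) = V * M"
    by (rule eq_matI)
      (auto simp: M_def V_def scalar_prod_def D' atLeast0LessThan)
  then have eq: "wronskian n \<phi>' = wronskian n \<phi> * Determinant.det M"
    using det_mult[OF carr(2,1)] by (simp add: wronskian_def V_def)
  then show "wronskian n \<phi> \<noteq> 0"
    using W by auto
  have "Determinant.det M \<in> ord_ge 0 q"
    unfolding M_def by (intro det_ord_ge) (simp add: ord_ge_iff)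
  then show "ord q (wronskian n \<phi>) \<le> ord q (wronskian n \<phi>')"
    using W eq by (auto simp: ord_mult ord_ge_iff)
qed


section \<open>Weights of Weierstrass points\<close>

lemma finite_ord_support:
  assumes "f \<noteq> 0"
  shows "finite {q. ord q f \<noteq> 0}"
proof -
  obtain p r where pr: "r \<noteq> 0" "f = Fract p r"
    by (metis ratfun_cases)
  have p: "p \<noteq> 0"
    using assms pr by (auto simp: Zero_fract_def eq_fract)
  have f: "f = to_fract p / to_fract r"
    using pr by (simp add: Fract_conv_to_fract)
  have "{q. ord q f \<noteq> 0} \<subseteq> insert None (Some ` ({a. poly p a = 0} \<union> {a. poly r a = 0}))"
  proof
    fix q
    assume "q \<in> {q. ord q f \<noteq> 0}"
    then show "q \<in> insert None (Some ` ({a. poly p a = 0} \<union> {a. poly r a = 0}))"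
      using p pr(1) unfolding f
      by (cases q) (auto simp: ord_divide ord_Some_to_fract order_root image_iff)
  qed
  then show ?thesis
    using p pr(1) poly_roots_finite[of p] poly_roots_finite[of r] finite_subset by fastforce
qed

lemma generates_tensor_power:
  assumes X: "rational_nodal_curve X" "x \<in> points X" and \<psi>: "generates X L x \<psi>"
  shows "generates X (tensor_power X m L) x (\<psi> ^ m)"
proof (induction m)
  case 0
  show ?case
    by (auto simp: generates_def)
next
  case (Suc m)
  let ?S = "stalk X x"
  have L: "L x = (*) \<psi> ` ?S" "tensor_power X m L x = (*) (\<psi> ^ m) ` ?S" and \<psi>0: "\<psi> \<noteq> 0"
    using \<psi> Suc by (auto simp: generates_def)
  have "module_product (L x) (tensor_power X m L x) = (*) (\<psi> ^ Suc m) ` ?S"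
  proof (intro equalityI subsetI)
    fix f
    assume "f \<in> module_product (L x) (tensor_power X m L x)"
    then obtain k :: nat and a b
      where ab: "\<And>i. i < k \<Longrightarrow> a i \<in> L x \<and> b i \<in> tensor_power X m L x" and f: "f = (\<Sum>i<k. a i * b i)"
      by (auto simp: module_product_def)
    have "a i * b i / \<psi> ^ Suc m \<in> ?S" if i: "i < k" for i
    proof -
      obtain s t where "s \<in> ?S" "t \<in> ?S" "a i = \<psi> * s" "b i = \<psi> ^ m * t"
        using ab[OF i] L by auto
      then show ?thesis
        using stalk_mult[OF X, of s t] \<psi>0 by simp
    qed
    then have "(\<Sum>i<k. a i * b i / \<psi> ^ Suc m) \<in> ?S"
      by (intro ratfun.subspace_sum[OF subspace_stalk[OF X]]) simp
    then have "f / \<psi> ^ Suc m \<in> ?S"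
      by (simp only: f sum_divide_distrib)
    then show "f \<in> (*) (\<psi> ^ Suc m) ` ?S"
      using mem_times_image_iff[of "\<psi> ^ Suc m"] \<psi>0 by simp
  next
    fix f
    assume "f \<in> (*) (\<psi> ^ Suc m) ` ?S"
    then obtain s where s: "s \<in> ?S" "f = \<psi> * (\<psi> ^ m * s)"
      by auto
    have "\<psi> * 1 \<in> L x"
      unfolding L using one_in_stalk[OF X] by blast
    then have mem: "\<psi> \<in> L x" "\<psi> ^ m * s \<in> tensor_power X m L x"
      using s(1) by (simp_all only: L(2) mult_1_right imageI)
    show "f \<in> module_product (L x) (tensor_power X m L x)"
      unfolding module_product_def mem_Collect_eq
      by (rule exI[of _ 1], rule exI[of _ "\<lambda>_. \<psi>"], rule exI[of _ "\<lambda>_. \<psi> ^ m * s"])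
        (simp add: mem s(2))
  qed
  then show ?case
    using \<psi>0 by (simp add: generates_def)
qed

lemma twice_sum_lessThan: "2 * (\<Sum>i<n. int i) = int n * (int n - 1)"
  by (induction n) (auto simp: algebra_simps)

text \<open>This is minus the degree of the canonical divisor of the projective line.\<close>

lemma sum_kappa: "finite T \<Longrightarrow> None \<in> T \<Longrightarrow> (\<Sum>q\<in>T. kappa q) = 2"
  by (simp add: kappa_def)

lemma sum_fibres:
  assumes X: "rational_nodal_curve X" and A: "finite A" "A \<subseteq> points X"
  shows "(\<Sum>x\<in>A. \<Sum>q\<in>normalization X -` {x}. f q) = (\<Sum>q\<in>normalization X -` A. f q)"
    and "finite (normalization X -` A)"
proof -
  have eq: "normalization X -` A = (\<Union>x\<in>A. normalization X -` {x})"
    by auto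
  have fin: "\<forall>x\<in>A. finite (normalization X -` {x})"
    using A(2) by (intro ballI finite_fibre[OF X]) auto
  then show "finite (normalization X -` A)"
    unfolding eq using A by blast
  show "(\<Sum>x\<in>A. \<Sum>q\<in>normalization X -` {x}. f q) = (\<Sum>q\<in>normalization X -` A. f q)"
    unfolding eq using A fin by (intro sum.UNION_disjoint[symmetric]) auto
qed

lemma node_in_points: "node X x \<Longrightarrow> x \<in> points X"
  by (auto simp: node_iff points_def)

lemma sum_over_nodes:
  assumes X: "rational_nodal_curve X"
  shows "(\<Sum>q | node X (normalization X q). f (normalization X q)) = (\<Sum>x | node X x. 2 * (f x :: real))"
    and "finite {q. node X (normalization X q)}"
proof -
  let ?V = "{x. node X x}"
  have V: "finite ?V" "?V \<subseteq> points X" "normalization X -` ?V = {q. node X (normalization X q)}"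
    using X node_in_points by (auto simp: rational_nodal_curve_def)
  show "finite {q. node X (normalization X q)}"
    using sum_fibres(2)[OF X V(1,2)] V(3) by simp
  have fibre: "(\<Sum>q\<in>normalization X -` {x}. f (normalization X q)) = 2 * f x" if "node X x" for x
  proof -
    have "(\<Sum>q\<in>normalization X -` {x}. f (normalization X q)) = (\<Sum>q\<in>normalization X -` {x}. f x)"
      by (intro sum.cong) auto
    also have "\<dots> = 2 * f x"
      using that unfolding node_iff by auto
    finally show ?thesis .
  qed
  have "(\<Sum>q | node X (normalization X q). f (normalization X q)) =
      (\<Sum>x | node X x. \<Sum>q\<in>normalization X -` {x}. f (normalization X q))"
    unfolding sum_fibres(1)[OF X V(1,2)] V(3) ..
  also have "\<dots> = (\<Sum>x | node X x. 2 * f x)"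
    by (rule sum.cong[OF refl]) (simp only: mem_Collect_eq fibre)
  finally show "(\<Sum>q | node X (normalization X q). f (normalization X q)) = (\<Sum>x | node X x. 2 * f x)" .
qed

section \<open>Bases of sections, their number and the resulting weights\<close>

lemma section_basis_wronskian_nonzero:
  assumes "section_basis X L \<phi>"
  shows "wronskian (h0 X L) \<phi> \<noteq> 0"
proof (rule wronskian_nonzero)
  fix c j
  assume c: "(\<Sum>j<h0 X L. cscale (c j) (\<phi> j)) = 0" and j: "j < h0 X L"
  let ?I = "{..<h0 X L}"
  have inj: "inj_on \<phi> ?I" and ind: "ratfun.independent (\<phi> ` ?I)"
    using assms by (auto simp: section_basis_def)
  have "(\<Sum>v\<in>\<phi> ` ?I. cscale (c (the_inv_into ?I \<phi> v)) v) = (\<Sum>j<h0 X L. cscale (c j) (\<phi> j))"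
    unfolding sum.reindex[OF inj] by (intro sum.cong refl) (simp add: the_inv_into_f_f[OF inj])
  then have "c (the_inv_into ?I \<phi> (\<phi> j)) = 0"
    using c j ind ratfun.dependent_finite[of "\<phi> ` ?I"] by auto
  then show "c j = 0"
    using the_inv_into_f_f[OF inj] j by simp
qed

lemma section_basis_wronskian_ord:
  assumes "section_basis X L \<phi>" "section_basis X L \<phi>'"
  shows "ord q (wronskian (h0 X L) \<phi>) = ord q (wronskian (h0 X L) \<phi>')"
proof -
  have span: "\<phi> j \<in> ratfun.span (\<phi>' ` {..<h0 X L})" "\<phi>' j \<in> ratfun.span (\<phi> ` {..<h0 X L})"
    if "j < h0 X L" for j
  proof -
    have "\<phi> j \<in> ratfun.span (\<phi> ` {..<h0 X L})" "\<phi>' j \<in> ratfun.span (\<phi>' ` {..<h0 X L})"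
      using that by (auto intro: ratfun.span_base)
    then show "\<phi> j \<in> ratfun.span (\<phi>' ` {..<h0 X L})" "\<phi>' j \<in> ratfun.span (\<phi> ` {..<h0 X L})"
      using assms by (simp_all add: section_basis_def)
  qed
  show ?thesis
    using assms section_basis_wronskian_nonzero span
    by (intro antisym wronskian_ord_le(2)) (auto simp: section_basis_def)
qed

context
  fixes X :: "('x, 'z) curve_scheme" and L :: "'x \<Rightarrow> ratfun set" and \<psi> :: "'x \<Rightarrow> ratfun"
    and e :: "p1 \<Rightarrow> int"
  assumes X: "rational_nodal_curve X"
    and \<psi>: "\<And>x. x \<in> points X \<Longrightarrow> generates X L x (\<psi> x)"
    and e: "\<And>q. e q = ord q (\<psi> (normalization X q))"
begin

lemma generates_tensor_power_ord:
  assumes "generates X (tensor_power X m L) (normalization X q) f"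
  shows "f \<noteq> 0" "ord q f = int m * e q"
proof -
  have x: "normalization X q \<in> points X"
    by (simp add: points_def)
  show "ord q f = int m * e q"
    using generates_ord_eq[OF X x assms generates_tensor_power[OF X x \<psi>[OF x]]] e
    by (simp add: ord_power)
  show "f \<noteq> 0"
    using assms by (simp add: generates_def)
qed

text \<open>The degree is computed on the normalization, where the pullback of \<open>L\<close> is
  the sheaf of the divisor with coefficients \<open>- e q\<close>.\<close>

lemma degree_eq_sum:
  assumes "sheaf_degree X L > 0"
  obtains T where "finite T" "\<And>q. q \<notin> T \<Longrightarrow> e q = 0" "(\<Sum>q\<in>T. e q) = - sheaf_degree X L"
proof -
  let ?B = "{x. x \<in> points X \<and> L x \<noteq> stalk X x}"
  \<comment> \<open>An infinite index set would make the sum 0 by convention, against the positive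
    degree.\<close>
  have "finite ?B"
  proof (rule ccontr)
    assume "infinite ?B"
    then have "sheaf_degree X L = 0"
      unfolding sheaf_degree_def by (rule sum.infinite)
    with assms show False
      by simp
  qed
  then have B: "finite ?B" "?B \<subseteq> points X"
    by auto
  have "e q = 0" if "q \<notin> normalization X -` ?B" for q
  proof -
    have x: "normalization X q \<in> points X"
      by (simp add: points_def)
    then have "generates X L (normalization X q) 1"
      using that by (auto simp: generates_def)
    then have "ord q (\<psi> (normalization X q)) = ord q 1"
      by (rule generates_ord_eq[OF X x \<psi>[OF x]]) simp
    then show ?thesis
      by (simp add: e)
  qed
  moreover have "(\<Sum>q\<in>normalization X -` ?B. e q) = - sheaf_degree X L"
  proof -
    have "local_degree X L x = - (\<Sum>q\<in>normalization X -` {x}. e q)" if "x \<in> ?B" for x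
    proof -
      have "local_degree X L x = - (\<Sum>q\<in>normalization X -` {x}. ord q (\<psi> x))"
        using local_degree_eq[OF X _ \<psi>] that by simp
      also have "\<dots> = - (\<Sum>q\<in>normalization X -` {x}. e q)"
        by (simp add: e)
      finally show ?thesis .
    qed
    then have "sheaf_degree X L = - (\<Sum>x\<in>?B. \<Sum>q\<in>normalization X -` {x}. e q)"
      by (simp add: sheaf_degree_def sum_negf)
    then show ?thesis
      by (simp add: sum_fibres(1)[OF X B])
  qed
  ultimately show thesis
    using that sum_fibres(2)[OF X B] by blast
qed

text \<open>The upper space consists of the sections of the pullback to the projective line, the
  lower one of those that vanish on all branches over the nodes and therefore descend. Both are
  given by orders alone.\<close>

lemma global_sections_tensor_power:
  "global_sections X (tensor_power X m L) \<subseteq> {f. \<forall>q. f \<in> ord_ge (int m * e q) q}"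
  "{f. \<forall>q. f \<in> ord_ge (int m * e q + of_bool (node X (normalization X q))) q} \<subseteq>
    global_sections X (tensor_power X m L)"
  "ratfun.subspace (global_sections X (tensor_power X m L))"
proof -
  have mem: "f \<in> tensor_power X m L x \<longleftrightarrow> f / \<psi> x ^ m \<in> stalk X x" and nz: "\<psi> x \<noteq> 0"
    if "x \<in> points X" for f x
    using generates_tensor_power[OF X that \<psi>[OF that], of m] \<psi>[OF that]
      mem_times_image_iff[of "\<psi> x ^ m"]
    by (auto simp: generates_def)
  have div: "f / \<psi> (normalization X q) ^ m \<in> ord_ge k q \<longleftrightarrow> f \<in> ord_ge (k + int m * e q) q" for f q k
    using nz[of "normalization X q"] by (simp add: divide_ord_ge_iff ord_power e points_def)
  show "global_sections X (tensor_power X m L) \<subseteq> {f. \<forall>q. f \<in> ord_ge (int m * e q) q}"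
  proof safe
    fix f q
    assume "f \<in> global_sections X (tensor_power X m L)"
    moreover have x: "normalization X q \<in> points X"
      by (simp add: points_def)
    ultimately have "f / \<psi> (normalization X q) ^ m \<in> stalk X (normalization X q)"
      using mem[OF x, of f] unfolding global_sections_def by blast
    then show "f \<in> ord_ge (int m * e q) q"
      using stalk_regular[OF X x _ refl] div[of f q 0] by simp
  qed
  show "{f. \<forall>q. f \<in> ord_ge (int m * e q + of_bool (node X (normalization X q))) q} \<subseteq>
      global_sections X (tensor_power X m L)"
  proof safe
    fix f
    assume f: "\<forall>q. f \<in> ord_ge (int m * e q + of_bool (node X (normalization X q))) q"
    have "f \<in> tensor_power X m L x" if x: "x \<in> points X" for x
      unfolding mem[OF x]
    proof (rule stalkI[OF X x])
      fix q
      assume q: "normalization X q = x"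
      have "f \<in> ord_ge (of_bool (node X x) + int m * e q) q"
        using f[rule_format, of q] q by (simp only: add.commute)
      then show "f / \<psi> x ^ m \<in> ord_ge (of_bool (node X x)) q"
        using div[of f q "of_bool (node X x)"] q by simp
    qed
    then show "f \<in> global_sections X (tensor_power X m L)"
      by (simp add: global_sections_def)
  qed
  show "ratfun.subspace (global_sections X (tensor_power X m L))"
  proof (rule ratfun.subspaceI)
    show "0 \<in> global_sections X (tensor_power X m L)"
      using mem subspace_stalk[OF X] by (simp add: global_sections_def ratfun.subspace_0)
  next
    fix f g
    assume "f \<in> global_sections X (tensor_power X m L)" "g \<in> global_sections X (tensor_power X m L)"
    then show "f + g \<in> global_sections X (tensor_power X m L)"
      using mem subspace_stalk[OF X]
      by (simp add: global_sections_def ratfun.subspace_add add_divide_distrib)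
  next
    fix c f
    assume "f \<in> global_sections X (tensor_power X m L)"
    moreover have "cscale c f / g = cscale c (f / g)" for g
      by (simp add: cscale_def)
    ultimately show "cscale c f \<in> global_sections X (tensor_power X m L)"
      using mem subspace_stalk[OF X]
      by (simp add: global_sections_def ratfun.subspace_scale)
  qed
qed

text \<open>Finite dimension comes from the upper space, the bound on \<open>h0\<close> from the
  lower one. The assumption on \<open>m * d\<close> keeps the degree nonnegative after one is
  subtracted for each branch, as \<open>riemann_roch_genus_0\<close> requires.\<close>

lemma section_basis_exists:
  assumes T: "finite T" "\<And>q. q \<notin> T \<Longrightarrow> e q = 0" and d: "(\<Sum>q\<in>T. e q) = - int d"
    and m: "m * d \<ge> 2 * card {x. node X x}"
  obtains \<phi> where "section_basis X (tensor_power X m L) \<phi>"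
    and "m * d + 1 \<le> h0 X (tensor_power X m L) + 2 * card {x. node X x}"
proof -
  let ?H = "global_sections X (tensor_power X m L)"
  define V where "V = {q. node X (normalization X q)}"
  have "real (card V) = real (2 * card {x. node X x})"
    using sum_over_nodes(1)[OF X, of "\<lambda>_. 1"] by (simp add: V_def)
  then have V: "finite V" "card V = 2 * card {x. node X x}"
    using sum_over_nodes(2)[OF X] by (simp_all only: of_nat_eq_iff V_def)
  obtain S1 where S1: "finite S1" "ratfun.span S1 = {f. \<forall>q. f \<in> ord_ge (int m * e q) q}"
    by (rule riemann_roch_genus_0[of T "\<lambda>q. int m * e q" "m * d"])
      (use T d in \<open>auto simp: sum_distrib_left[symmetric]\<close>)
  have "(\<Sum>q\<in>T \<union> V. int m * e q + of_bool (q \<in> V)) = int m * (\<Sum>q\<in>T \<union> V. e q) + (\<Sum>q\<in>T \<union> V. of_bool (q \<in> V))"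
    by (simp add: sum.distrib sum_distrib_left)
  also have "(\<Sum>q\<in>T \<union> V. e q) = (\<Sum>q\<in>T. e q)"
    by (rule sum.mono_neutral_right) (use T V in auto)
  also have "(\<Sum>q\<in>T \<union> V. of_bool (q \<in> V)) = int (card V)"
  proof -
    have "(\<Sum>q\<in>T \<union> V. of_bool (q \<in> V)) = (\<Sum>q\<in>V. 1 :: int)"
      by (rule sum.mono_neutral_cong_right) (use T V in auto)
    then show ?thesis
      by simp
  qed
  finally have sum: "(\<Sum>q\<in>T \<union> V. int m * e q + of_bool (q \<in> V)) = - int (m * d - 2 * card {x. node X x})"
    using d m V by (simp add: of_nat_diff)
  obtain S2 where S2: "card S2 = m * d - 2 * card {x. node X x} + 1" "ratfun.independent S2"
    "ratfun.span S2 = {f. \<forall>q. f \<in> ord_ge (int m * e q + of_bool (q \<in> V)) q}"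
    by (rule riemann_roch_genus_0[OF _ _ sum]) (use T V in auto)
  obtain B where B: "B \<subseteq> ?H" "ratfun.independent B" "?H \<subseteq> ratfun.span B" "card B = ratfun.dim ?H"
    by (rule ratfun.basis_exists)
  have "B \<subseteq> ratfun.span S1"
    using B(1) global_sections_tensor_power(1) S1(2) by blast
  then have fB: "finite B"
    using ratfun.independent_span_bound[OF S1(1) B(2)] by blast
  have "S2 \<subseteq> ratfun.span S2"
    by (rule ratfun.span_superset)
  also have "\<dots> \<subseteq> ?H"
    unfolding S2 using global_sections_tensor_power(2) by (simp add: V_def)
  also note B(3)
  finally have "card S2 \<le> card B"
    using ratfun.independent_span_bound[OF fB S2(2)] by blast
  then have card: "m * d + 1 \<le> h0 X (tensor_power X m L) + 2 * card {x. node X x}"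
    using S2(1) B(4) m by (simp add: h0_def)
  obtain \<phi> where "bij_betw \<phi> {0..<card B} B"
    using ex_bij_betw_nat_finite[OF fB] by blast
  then have \<phi>: "inj_on \<phi> {..<card B}" "\<phi> ` {..<card B} = B"
    by (simp_all add: bij_betw_def atLeast0LessThan)
  have "ratfun.span B = ?H"
    using B ratfun.span_minimal[OF B(1) global_sections_tensor_power(3)] by blast
  then have "section_basis X (tensor_power X m L) \<phi>"
    using \<phi> B by (simp add: section_basis_def h0_def)
  with card that show thesis
    by blast
qed

text \<open>The description in \<open>weierstrass_weight\<close> asks that all germs have the same
  order, whatever basis and generators were chosen; and \<open>ord_at\<close> is the sum over the
  branches once the germ is known to lie in the stalk.\<close>

lemma weierstrass_weight_eq:
  assumes \<phi>: "section_basis X (tensor_power X m L) \<phi>" and n: "n = h0 X (tensor_power X m L)" "2 \<le> n"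
    and \<epsilon>: "\<And>q. \<epsilon> q = ord q (wronskian n \<phi>) - int n * (int m * e q) - (\<Sum>i<n. int i) * kappa q"
  shows "0 \<le> \<epsilon> q"
    and "x \<in> points X \<Longrightarrow> int (weierstrass_weight X (tensor_power X m L) x) =
      (\<Sum>q\<in>normalization X -` {x}. \<epsilon> q + of_bool (node X x) * (\<Sum>i<n. int i))"
proof -
  let ?Lm = "tensor_power X m L" and ?b = "\<Sum>i<n. int i"
  have W: "wronskian n \<phi> \<noteq> 0"
    using section_basis_wronskian_nonzero[OF \<phi>] by (simp add: n)
  have \<epsilon>0: "0 \<le> \<epsilon> q" for q
  proof -
    have mem: "\<phi> j \<in> ord_ge (int m * e q) q" if "j < n" for j
    proof -
      have "\<phi> j \<in> ratfun.span (\<phi> ` {..<n})"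
        using that by (auto intro: ratfun.span_base)
      then show ?thesis
        using \<phi> global_sections_tensor_power(1) by (auto simp: section_basis_def n)
    qed
    show ?thesis
      using wronskian_ord_ge[OF W mem] by (simp add: \<epsilon>)
  qed
  then show "0 \<le> \<epsilon> q" .
  \<comment> \<open>This is where \<open>2 \<le> n\<close> enters: with \<open>?b\<close> at least 1
    the germ vanishes on both branches over a node, so \<open>stalkI\<close> applies.\<close>
  have "(\<Sum>i<2. int i) \<le> ?b"
    using n(2) by (intro sum_mono2) auto
  then have b: "1 \<le> ?b"
    by (simp add: numeral_2_eq_2)
  assume x: "x \<in> points X"
  have germ: "int (ord_at X x f) = (\<Sum>q\<in>normalization X -` {x}. \<epsilon> q + of_bool (node X x) * ?b)"
    if f: "wronskian_germ X ?Lm x f" for f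
  proof -
    obtain \<phi>' \<psi>' \<tau> where *: "section_basis X ?Lm \<phi>'" "generates X ?Lm x \<psi>'"
      "generates X (dualizing_sheaf X) x \<tau>"
      "f = Determinant.det (mat n n (\<lambda>(i, j). wronskian_entry \<psi>' \<tau> i (\<phi>' j)))"
      using f unfolding wronskian_germ_def n by blast
    have nz: "\<psi>' \<noteq> 0" "\<tau> \<noteq> 0"
      using *(2,3) by (simp_all add: generates_def)
    have W': "wronskian n \<phi>' \<noteq> 0"
      using section_basis_wronskian_nonzero[OF *(1)] by (simp add: n)
    have f0: "f \<noteq> 0"
      using ord_det_wronskian_entry(1)[OF nz W'] by (simp add: *(4))
    have ordf: "ord q f = \<epsilon> q + of_bool (node X x) * ?b" if q: "normalization X q = x" for q
    proof -
      have 1: "ord q \<psi>' = int m * e q"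
        using generates_tensor_power_ord(2)[of m q \<psi>'] *(2) q by simp
      have 2: "ord q \<tau> = kappa q - of_bool (node X x)"
        by (rule dualizing_generator_ord[OF X x *(3) q])
      have 3: "ord q (wronskian n \<phi>') = ord q (wronskian n \<phi>)"
        using section_basis_wronskian_ord[OF *(1) \<phi>] by (simp add: n)
      \<comment> \<open>Substituting the three orders leaves \<open>\<epsilon> q\<close> plus
        \<open>?b\<close> times the pole order of \<tau> dt.\<close>
      show ?thesis
        unfolding *(4) ord_det_wronskian_entry(2)[OF nz W'] 1 2 3 \<epsilon> by (simp add: algebra_simps)
    qed
    have "f \<in> stalk X x"
    proof (rule stalkI[OF X x])
      fix q
      assume "normalization X q = x"
      then show "f \<in> ord_ge (of_bool (node X x)) q"
        using ordf[of q] \<epsilon>0[of q] b by (auto simp: ord_ge_iff)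
    qed
    then have "int (ord_at X x f) = (\<Sum>q\<in>normalization X -` {x}. ord q f)"
      by (rule ord_at_eq[OF X x f0])
    also have "\<dots> = (\<Sum>q\<in>normalization X -` {x}. \<epsilon> q + of_bool (node X x) * ?b)"
      using ordf by (intro sum.cong) auto
    finally show ?thesis .
  qed
  obtain \<tau> where "generates X (dualizing_sheaf X) x \<tau>"
    by (rule dualizing_generator_exists[OF X x])
  then have "\<exists>f. wronskian_germ X ?Lm x f"
    unfolding wronskian_germ_def using \<phi> generates_tensor_power[OF X x \<psi>[OF x]] by blast
  then obtain f where f: "wronskian_germ X ?Lm x f"
    by blast
  have "weierstrass_weight X ?Lm x = ord_at X x f"
    unfolding weierstrass_weight_def
  proof (rule the_equality)
    show "\<exists>f'. wronskian_germ X ?Lm x f' \<and> ord_at X x f = ord_at X x f'"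
      using f by blast
  next
    fix w
    assume "\<exists>f. wronskian_germ X ?Lm x f \<and> w = ord_at X x f"
    then show "w = ord_at X x f"
      using germ f by (metis of_nat_eq_iff)
  qed
  then show "int (weierstrass_weight X ?Lm x) =
      (\<Sum>q\<in>normalization X -` {x}. \<epsilon> q + of_bool (node X x) * ?b)"
    using germ[OF f] by simp
qed

end

lemma weierstrass_weight_decomposition:
  assumes X: "rational_nodal_curve X" and L: "invertible_sheaf X L" and deg: "sheaf_degree X L > 0"
    and m: "int m * sheaf_degree X L \<ge> 2 * int (card {x. node X x}) + 1"
  obtains n T and \<epsilon> :: "p1 \<Rightarrow> real"
  where "int m * sheaf_degree X L + 1 \<le> int n + 2 * int (card {x. node X x})" "2 \<le> n"
    and "finite T" "\<And>q. q \<notin> T \<Longrightarrow> \<epsilon> q = 0" "\<And>q. 0 \<le> \<epsilon> q"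
    and "(\<Sum>q\<in>T. \<epsilon> q) \<le> 2 * real (card {x. node X x}) * real n"
    and "\<And>x. x \<in> points X \<Longrightarrow> real (weierstrass_weight X (tensor_power X m L) x) =
      (\<Sum>q\<in>normalization X -` {x}. \<epsilon> q + of_bool (node X x) * (real n * (real n - 1) / 2))"
proof -
  obtain \<psi> where \<psi>: "\<And>x. x \<in> points X \<Longrightarrow> generates X L x (\<psi> x)"
    using L unfolding invertible_sheaf_def by metis
  define e where "e q = ord q (\<psi> (normalization X q))" for q
  note ctx = X \<psi> e_def
  obtain T where T: "finite T" "\<And>q. q \<notin> T \<Longrightarrow> e q = 0" "(\<Sum>q\<in>T. e q) = - sheaf_degree X L"
    using degree_eq_sum[OF ctx deg] by blast
  define d where "d = nat (sheaf_degree X L)"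
  have d: "sheaf_degree X L = int d"
    using deg by (simp add: d_def)
  have "int (2 * card {x. node X x} + 1) \<le> int (m * d)"
    using m by (simp add: d)
  then have md: "2 * card {x. node X x} + 1 \<le> m * d"
    by (simp only: of_nat_le_iff)
  then obtain \<phi> where \<phi>: "section_basis X (tensor_power X m L) \<phi>"
    "m * d + 1 \<le> h0 X (tensor_power X m L) + 2 * card {x. node X x}"
    using section_basis_exists[OF ctx T(1,2), of d m] T(3) d by auto
  define n where "n = h0 X (tensor_power X m L)"
  define \<epsilon> where "\<epsilon> q = ord q (wronskian n \<phi>) - int n * (int m * e q) - (\<Sum>i<n. int i) * kappa q" for q
  \<comment> \<open>The \<open>+ 1\<close> in the assumption on \<open>m\<close> is what raises
    \<open>n\<close> to at least 2.\<close>
  have n: "2 \<le> n" "m * d + 1 \<le> n + 2 * card {x. node X x}"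
    using \<phi>(2) md by (simp_all add: n_def)
  have \<epsilon>_nonneg: "0 \<le> \<epsilon> q" for q
    by (rule weierstrass_weight_eq(1)[OF ctx \<phi>(1) n_def n(1) \<epsilon>_def])
  have weight: "int (weierstrass_weight X (tensor_power X m L) x) =
      (\<Sum>q\<in>normalization X -` {x}. \<epsilon> q + of_bool (node X x) * (\<Sum>i<n. int i))" if "x \<in> points X" for x
    by (rule weierstrass_weight_eq(2)[OF ctx \<phi>(1) n_def n(1) \<epsilon>_def that])
  have W: "wronskian n \<phi> \<noteq> 0"
    using section_basis_wronskian_nonzero[OF \<phi>(1)] by (simp add: n_def)
  \<comment> \<open>\<open>U\<close> collects all points where some term of \<epsilon> can be
    nonzero; infinity is included because of \<open>kappa\<close>.\<close>
  define U where "U = insert None (T \<union> {q. ord q (wronskian n \<phi>) \<noteq> 0})"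
  have U: "finite U" "None \<in> U"
    using T finite_ord_support[OF W] by (simp_all add: U_def)
  have \<epsilon>0: "\<epsilon> q = 0" if "q \<notin> U" for q
    using that T by (auto simp: U_def \<epsilon>_def kappa_def)
  have "(\<Sum>q\<in>U. e q) = (\<Sum>q\<in>T. e q)"
    by (rule sum.mono_neutral_right) (use T U in \<open>auto simp: U_def\<close>)
  moreover have "(\<Sum>q\<in>U. ord q (wronskian n \<phi>)) = 0"
    by (rule principal_divisor_degree[OF W U(1)]) (auto simp: U_def)
  moreover have "(\<Sum>q\<in>U. \<epsilon> q) = (\<Sum>q\<in>U. ord q (wronskian n \<phi>))
      - int n * (int m * (\<Sum>q\<in>U. e q)) - (\<Sum>i<n. int i) * (\<Sum>q\<in>U. kappa q)"
    by (simp add: \<epsilon>_def sum_subtractf sum_distrib_left)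
  \<comment> \<open>The divisor of the Wronskian sums to 0, \<open>e\<close> to minus the degree,
    and \<open>kappa\<close> to 2.\<close>
  ultimately have "(\<Sum>q\<in>U. \<epsilon> q) = int n * (int m * int d) - 2 * (\<Sum>i<n. int i)"
    using T(3) d sum_kappa[OF U] by simp
  also have "\<dots> = int n * (int (m * d) - int n + 1)"
    by (simp add: twice_sum_lessThan algebra_simps)
  also have "\<dots> \<le> int n * (2 * int (card {x. node X x}))"
  proof (rule mult_left_mono)
    have "int (m * d + 1) \<le> int (n + 2 * card {x. node X x})"
      using n(2) by (simp only: of_nat_le_iff)
    then show "int (m * d) - int n + 1 \<le> 2 * int (card {x. node X x})"
      by simp
  qed simp
  finally have "real_of_int (\<Sum>q\<in>U. \<epsilon> q) \<le> real_of_int (int n * (2 * int (card {x. node X x})))"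
    by (simp only: of_int_le_iff)
  then have sum: "(\<Sum>q\<in>U. real_of_int (\<epsilon> q)) \<le> 2 * real (card {x. node X x}) * real n"
    by (simp add: mult_ac)
  have b: "real_of_int (\<Sum>i<n. int i) = real n * (real n - 1) / 2"
    using arg_cong[OF twice_sum_lessThan[of n], of real_of_int] by simp
  show thesis
  proof (rule that[of n U "\<lambda>q. real_of_int (\<epsilon> q)"])
    show "int m * sheaf_degree X L + 1 \<le> int n + 2 * int (card {x. node X x})"
    proof -
      have "int (m * d + 1) \<le> int (n + 2 * card {x. node X x})"
        using n(2) by (simp only: of_nat_le_iff)
      then show ?thesis
        by (simp add: d)
    qed
    show "real (weierstrass_weight X (tensor_power X m L) x) = (\<Sum>q\<in>normalization X -` {x}.
        real_of_int (\<epsilon> q) + of_bool (node X x) * (real n * (real n - 1) / 2))" if "x \<in> points X" for x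
      using arg_cong[OF weight[OF that], of real_of_int]
      unfolding b[symmetric] by simp
  qed (use U \<epsilon>0 sum n \<epsilon>_nonneg in auto)
qed


section \<open>Convergence of the measures\<close>

text \<open>\<open>measure_of\<close> takes the intended values only if the set function is
  countably additive. This is inherited from the image \<open>N\<close> of a point measure under
  \<open>p\<close>, and the same identification reduces the integral to a finite sum.\<close>

lemma integral_dirac_sum:
  assumes I: "finite I" "\<And>i. i \<in> I \<Longrightarrow> p i \<in> topspace T" "\<And>i. i \<in> I \<Longrightarrow> 0 \<le> c i"
    and f: "continuous_map T euclideanreal f"
  shows "integral\<^sup>L (dirac_sum T I c p) f = (\<Sum>i\<in>I. c i * f (p i))"
proof -
  define S where "S = sigma (topspace T) {U. openin T U}"
  have sub: "{U. openin T U} \<subseteq> Pow (topspace T)"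
    by (auto dest: openin_subset)
  have sets_S: "sets S = sigma_sets (topspace T) {U. openin T U}" and space_S: "space S = topspace T"
    using sub by (simp_all add: S_def sets_measure_of space_measure_of)
  define M where "M = point_measure I (\<lambda>i. ennreal (c i))"
  have p: "p \<in> measurable M S"
    using I(2) unfolding M_def space_S[symmetric] by (auto simp: measurable_def space_point_measure sets_point_measure)
  define N where "N = distr M S p"
  have emeasure_N: "emeasure N A = (\<Sum>i\<in>I. ennreal (c i) * indicator A (p i))" if A: "A \<in> sets S" for A
  proof -
    have "emeasure N A = emeasure M (p -` A \<inter> I)"
      using A p by (simp add: N_def emeasure_distr) (simp add: M_def space_point_measure)
    also have "\<dots> = (\<Sum>i\<in>p -` A \<inter> I. ennreal (c i))"
      using I(1) by (simp add: M_def emeasure_point_measure_finite)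
    also have "\<dots> = (\<Sum>i\<in>I. ennreal (c i) * indicator A (p i))"
      using I(1) by (intro sum.mono_neutral_cong_left) (auto simp: indicator_def)
    finally show ?thesis .
  qed
  have "dirac_sum T I c p = N"
  proof (rule measure_eqI)
    show sets: "sets (dirac_sum T I c p) = sets N"
      using sub by (simp add: dirac_sum_def N_def sets_S sets_measure_of)
    fix A
    assume A: "A \<in> sets (dirac_sum T I c p)"
    have ca: "countably_additive (sets N) (\<lambda>A. \<Sum>i\<in>I. ennreal (c i) * indicator A (p i))"
      using emeasure_countably_additive[of N] emeasure_N unfolding countably_additive_def
      by (simp add: N_def image_subset_iff sets.countable_UN)
    have "emeasure (dirac_sum T I c p) A = (\<Sum>i\<in>I. ennreal (c i) * indicator A (p i))"
    proof (rule emeasure_measure_of[OF dirac_sum_def sub])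
      show "positive (sets (dirac_sum T I c p)) (\<lambda>A. \<Sum>i\<in>I. ennreal (c i) * indicator A (p i))"
        by (simp add: positive_def)
    qed (use ca A sets in simp_all)
    also have "\<dots> = emeasure N A"
      using A emeasure_N by (simp add: sets N_def)
    finally show "emeasure (dirac_sum T I c p) A = emeasure N A" .
  qed
  moreover have "f \<in> borel_measurable S"
  proof (rule borel_measurableI)
    fix U :: "real set"
    assume "open U"
    then have "openin T {x \<in> topspace T. f x \<in> U}"
      using f by (auto simp: continuous_map_def)
    moreover have "{x \<in> topspace T. f x \<in> U} = f -` U \<inter> space S"
      by (auto simp: space_S)
    ultimately show "f -` U \<inter> space S \<in> sets S"
      by (simp add: sets_S)
  qed
  then have "integral\<^sup>L N f = integral\<^sup>L M (\<lambda>i. f (p i))"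
    unfolding N_def by (rule integral_distr[OF p])
  moreover have "\<dots> = (\<Sum>i\<in>I. c i * f (p i))"
    unfolding M_def using I by (simp add: lebesgue_integral_point_measure_finite)
  ultimately show ?thesis
    by simp
qed

lemma topspace_p1_topology [simp]: "topspace p1_topology = UNIV"
proof -
  have "q \<in> insert None (Some ` UNIV)" for q :: p1
    by (cases q) auto
  then show ?thesis
    by (auto simp: p1_topology_def)
qed

lemma topspace_curve_topology [simp]: "topspace (curve_topology X) = points X"
proof -
  have "normalization X -` points X = UNIV"
    by (auto simp: points_def)
  then have "openin (curve_topology X) (points X)"
    using openin_topspace[of p1_topology] by (simp add: openin_curve_topology)
  moreover have "topspace (curve_topology X) \<subseteq> points X"
    using openin_topspace[of "curve_topology X"] by (simp only: openin_curve_topology)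
  ultimately show ?thesis
    using openin_subset by blast
qed

text \<open>The curve is a continuous image of the compact Riemann sphere.\<close>

lemma continuous_on_curve_bounded:
  assumes "continuous_map (curve_topology X) euclideanreal f"
  obtains B where "0 \<le> B" "\<And>x. x \<in> points X \<Longrightarrow> \<bar>f x\<bar> \<le> B"
proof -
  have "continuous_map p1_topology (curve_topology X) (normalization X)"
    by (auto simp: continuous_map_def openin_curve_topology vimage_def points_def)
  then have cont: "continuous_map p1_topology euclideanreal (f \<circ> normalization X)"
    using assms by (rule continuous_map_compose)
  have "compact_space p1_topology"
    by (simp add: p1_topology_def)
  then have "compactin p1_topology UNIV"
    by (simp add: compact_space_def)
  then have "compact ((f \<circ> normalization X) ` UNIV)"
    using image_compactin[OF _ cont] by simp
  then obtain B where B: "\<And>y. y \<in> (f \<circ> normalization X) ` UNIV \<Longrightarrow> norm y \<le> B"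
    using compact_imp_bounded bounded_iff by metis
  have "\<bar>f x\<bar> \<le> B" if "x \<in> points X" for x
    using B[of "f x"] that by (auto simp: points_def)
  moreover have "0 \<le> B"
    using calculation[of "normalization X None"] by (simp add: points_def)
  ultimately show thesis
    using that by blast
qed

text \<open>The integral is \<open>(A + 2 * b * S) / Z\<close> with
  \<open>Z = E + 2 * b * real g\<close>: a part of mass \<open>E\<close> spread along \<epsilon>,
  and the node part. The distance to \<open>S / real g\<close> is at most
  \<open>2 * E * B / Z\<close>; inserting E \<le> 2 g n and Z \<ge> g n (n - 1) produces the
  constant 4 and the denominator n - 1.\<close>

lemma weierstrass_measure_estimate:
  assumes X: "rational_nodal_curve X" and L: "invertible_sheaf X L" and deg: "sheaf_degree X L > 0"
    and g: "card {x. node X x} = g" "0 < g"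
    and m: "int m * sheaf_degree X L \<ge> 2 * int g + 1"
    and f: "continuous_map (curve_topology X) euclideanreal f"
    and B: "\<And>x. x \<in> points X \<Longrightarrow> \<bar>f x\<bar> \<le> B"
  shows "\<bar>integral\<^sup>L (weierstrass_measure X (tensor_power X m L)) f - (\<Sum>x | node X x. f x) / real g\<bar>
    \<le> 4 * B / real_of_int (int m * sheaf_degree X L - 2 * int g)"
proof -
  obtain n T and \<epsilon> :: "p1 \<Rightarrow> real" where n: "int m * sheaf_degree X L + 1 \<le> int n + 2 * int g" "2 \<le> n"
    and T: "finite T" and \<epsilon>: "\<And>q. q \<notin> T \<Longrightarrow> \<epsilon> q = 0" "\<And>q. 0 \<le> \<epsilon> q"
    and sum\<epsilon>: "(\<Sum>q\<in>T. \<epsilon> q) \<le> 2 * real g * real n"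
    and weight: "\<And>x. x \<in> points X \<Longrightarrow> real (weierstrass_weight X (tensor_power X m L) x) =
      (\<Sum>q\<in>normalization X -` {x}. \<epsilon> q + of_bool (node X x) * (real n * (real n - 1) / 2))"
    using weierstrass_weight_decomposition[OF X L deg] m unfolding g(1) by metis
  define V where "V = {q. node X (normalization X q)}"
  have V: "finite V"
    using sum_over_nodes(2)[OF X] by (simp add: V_def)
  define w where "w = weierstrass_weight X (tensor_power X m L)"
  define P where "P = weierstrass_points X (tensor_power X m L)"
  define b where "b = real n * (real n - 1) / 2"
  define E where "E = (\<Sum>q\<in>T. \<epsilon> q)"
  have b: "1 \<le> b"
    using n(2) mult_mono[of 2 "real n" 1 "real n - 1"] by (simp add: b_def)
  have E: "0 \<le> E" "E \<le> 2 * real g * real n"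
    using \<epsilon>(2) sum\<epsilon> by (simp_all add: E_def sum_nonneg)
  let ?R = "normalization X ` (T \<union> V)"
  have R: "finite ?R" "?R \<subseteq> points X"
    using T V by (auto simp: points_def)
  have P: "P \<subseteq> ?R"
  proof
    fix x
    assume "x \<in> P"
    then have x: "x \<in> points X" "0 < real (w x)"
      by (simp_all add: P_def weierstrass_points_def w_def)
    show "x \<in> ?R"
    proof (rule ccontr)
      assume "x \<notin> ?R"
      then have "\<epsilon> q + of_bool (node X x) * (real n * (real n - 1) / 2) = 0" if "q \<in> normalization X -` {x}" for q
        using that \<epsilon>(1)[of q] by (auto simp: V_def)
      then have "real (w x) = 0"
        unfolding w_def weight[OF x(1)] by (intro sum.neutral) blast
      with x(2) show False
        by simp
    qed
  qed
  then have finP: "finite P" "P \<subseteq> points X"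
    using R finite_subset by (blast, auto)
  \<comment> \<open>Kept for general \<open>h\<close>: the constant 1 gives the total weight,
    \<open>f\<close> the integral.\<close>
  have total: "(\<Sum>x\<in>P. real (w x) * h x) = (\<Sum>q\<in>T. \<epsilon> q * h (normalization X q)) + 2 * b * (\<Sum>x | node X x. h x)" for h
  proof -
    let ?t = "\<lambda>q. \<epsilon> q * h (normalization X q)"
    let ?s = "\<lambda>q. of_bool (q \<in> V) * (b * h (normalization X q))"
    have "(\<Sum>x\<in>P. real (w x) * h x) = (\<Sum>x\<in>?R. real (w x) * h x)"
    proof (rule sum.mono_neutral_left)
      show "\<forall>x\<in>?R - P. real (w x) * h x = 0"
        using R(2) by (auto simp: P_def weierstrass_points_def w_def points_def)
    qed (use P R in auto)
    also have "\<dots> = (\<Sum>x\<in>?R. \<Sum>q\<in>normalization X -` {x}. ?t q + ?s q)"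
    proof (rule sum.cong[OF refl])
      fix x
      assume "x \<in> ?R"
      then have "x \<in> points X"
        using R by auto
      then show "real (w x) * h x = (\<Sum>q\<in>normalization X -` {x}. ?t q + ?s q)"
        unfolding w_def weight[OF \<open>x \<in> points X\<close>] sum_distrib_right
        by (intro sum.cong) (auto simp: V_def b_def algebra_simps)
    qed
    also have "\<dots> = (\<Sum>q\<in>normalization X -` ?R. ?t q + ?s q)"
      by (rule sum_fibres(1)[OF X R])
    also have "\<dots> = (\<Sum>q\<in>T \<union> V. ?t q + ?s q)"
      using sum_fibres(2)[OF X R] \<epsilon>(1) by (intro sum.mono_neutral_right) auto
    also have "\<dots> = (\<Sum>q\<in>T \<union> V. ?t q) + (\<Sum>q\<in>T \<union> V. ?s q)"
      by (rule sum.distrib)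
    also have "(\<Sum>q\<in>T \<union> V. ?t q) = (\<Sum>q\<in>T. ?t q)"
      by (rule sum.mono_neutral_right) (use T V \<epsilon>(1) in auto)
    also have "(\<Sum>q\<in>T \<union> V. ?s q) = (\<Sum>q\<in>V. b * h (normalization X q))"
      by (rule sum.mono_neutral_cong_right) (use T V in auto)
    also have "\<dots> = 2 * b * (\<Sum>x | node X x. h x)"
      unfolding V_def sum_over_nodes(1)[OF X, of "\<lambda>x. b * h x"]
      by (simp add: sum_distrib_left mult_ac)
    finally show ?thesis .
  qed
  define Z where "Z = (\<Sum>x\<in>P. real (w x))"
  have Z: "Z = E + 2 * b * real g"
    using total[of "\<lambda>_. 1"] by (simp add: Z_def E_def g)
  have bg: "0 < 2 * b * real g"
    using b g by simp
  have Z0: "0 < Z"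
    unfolding Z using bg E by linarith
  have "integral\<^sup>L (weierstrass_measure X (tensor_power X m L)) f = (\<Sum>x\<in>P. real (w x) / Z * f x)"
    unfolding weierstrass_measure_def P_def[symmetric] w_def[symmetric] Z_def[symmetric]
    using finP Z0 f by (subst integral_dirac_sum) auto
  also have "\<dots> = (\<Sum>x\<in>P. real (w x) * f x) / Z"
    by (simp add: sum_divide_distrib)
  finally have int: "integral\<^sup>L (weierstrass_measure X (tensor_power X m L)) f = (\<Sum>x\<in>P. real (w x) * f x) / Z" .
  define A where "A = (\<Sum>q\<in>T. \<epsilon> q * f (normalization X q))"
  define S where "S = (\<Sum>x | node X x. f x)"
  have "\<bar>A\<bar> \<le> (\<Sum>q\<in>T. \<epsilon> q * B)"
    unfolding A_def
  proof (rule sum_abs[THEN order_trans], rule sum_mono)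
    fix q
    show "\<bar>\<epsilon> q * f (normalization X q)\<bar> \<le> \<epsilon> q * B"
      using \<epsilon>(2)[of q] B[of "normalization X q"] by (simp add: abs_mult mult_left_mono points_def)
  qed
  then have A: "\<bar>A\<bar> \<le> E * B"
    by (simp add: E_def sum_distrib_right)
  have "\<bar>S\<bar> \<le> (\<Sum>x | node X x. B)"
    unfolding S_def by (rule sum_abs[THEN order_trans], rule sum_mono) (simp add: B node_in_points)
  then have S: "\<bar>S\<bar> \<le> real g * B"
    by (simp add: g)
  have "\<bar>real g * A - E * S\<bar> \<le> real g * \<bar>A\<bar> + E * \<bar>S\<bar>"
    using abs_triangle_ineq4[of "real g * A" "E * S"] E by (simp add: abs_mult)
  also have "\<dots> \<le> real g * (E * B) + E * (real g * B)"
    using A S E by (intro add_mono mult_left_mono) auto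
  finally have num: "\<bar>real g * A - E * S\<bar> \<le> 2 * real g * E * B"
    by (simp add: algebra_simps)
  have B0: "0 \<le> B"
    using B[of "normalization X None"] by (auto simp: points_def)
  \<comment> \<open>Over the common denominator the terms with \<open>2 * b\<close> cancel, so the
    numerator is only linear in \<epsilon>.\<close>
  have "(A + 2 * b * S) / Z - S / real g = (real g * A - E * S) / (Z * real g)"
    using Z0 g by (simp add: field_simps Z)
  then have "\<bar>(A + 2 * b * S) / Z - S / real g\<bar> = \<bar>real g * A - E * S\<bar> / (Z * real g)"
    using Z0 by (simp add: abs_divide)
  also have "\<dots> \<le> (2 * real g * E * B) / (Z * real g)"
    using num Z0 by (intro divide_right_mono) auto
  also have "\<dots> = 2 * E * B / Z"
    using g by simp
  also have "\<dots> \<le> 2 * (2 * real g * real n) * B / Z"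
    using E B0 Z0 by (intro divide_right_mono mult_right_mono mult_left_mono) auto
  also have "\<dots> \<le> 2 * (2 * real g * real n) * B / (2 * b * real g)"
    using B0 bg E Z Z0 by (intro divide_left_mono) auto
  also have "\<dots> = 4 * B / (real n - 1)"
    using n(2) g by (simp add: b_def field_simps)
  also have "\<dots> \<le> 4 * B / real_of_int (int m * sheaf_degree X L - 2 * int g)"
  proof (rule divide_left_mono)
    have "real_of_int (int m * sheaf_degree X L - 2 * int g) \<le> real_of_int (int n - 1)"
      using n(1) by (simp only: of_int_le_iff)
    then show "real_of_int (int m * sheaf_degree X L - 2 * int g) \<le> real n - 1"
      by simp
    have "0 < real_of_int (int m * sheaf_degree X L - 2 * int g)"
      using m by (simp only: of_int_0_less_iff)
    then show "0 < (real n - 1) * real_of_int (int m * sheaf_degree X L - 2 * int g)"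
      using n(2) by simp
  qed (use B0 in simp)
  finally show ?thesis
    unfolding int total[of f] A_def S_def .
qed

theorem corollary1:
  fixes X :: "'x curve" and p :: "nat \<Rightarrow> 'x" and g :: nat and L :: "'x \<Rightarrow> ratfun set"
  assumes "g \<ge> 2"
    and "stable_rational_nodal_curve X"
    and "inj_on p {1..g}" and "{x. node X x} = p ` {1..g}"
    and "invertible_sheaf X L" and "sheaf_degree X L > 0"
  shows "weak_limit (curve_topology X) (\<lambda>m. weierstrass_measure X (tensor_power X m L))
           (dirac_sum (curve_topology X) {1..g} (\<lambda>_. 1 / real g) p)"
proof -
  have X: "rational_nodal_curve X"
    using assms(2) by (simp add: stable_rational_nodal_curve_def)
  have card: "card {x. node X x} = g" "0 < g"
    using assms(1,3,4) by (simp_all add: card_image)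
  show ?thesis
    unfolding weak_limit_def
  proof (intro allI impI)
    fix f
    assume f: "continuous_map (curve_topology X) euclideanreal f"
    obtain B where B: "0 \<le> B" "\<And>x. x \<in> points X \<Longrightarrow> \<bar>f x\<bar> \<le> B"
      using continuous_on_curve_bounded[OF f] by blast
    have p: "p i \<in> points X" if "i \<in> {1..g}" for i
      using that assms(4) by (intro node_in_points) auto
    have "integral\<^sup>L (dirac_sum (curve_topology X) {1..g} (\<lambda>_. 1 / real g) p) f =
        (\<Sum>i\<in>{1..g}. f (p i)) / real g"
      using p by (subst integral_dirac_sum[OF _ _ _ f]) (auto simp: sum_divide_distrib)
    also have "(\<Sum>i\<in>{1..g}. f (p i)) = (\<Sum>x | node X x. f x)"
      unfolding assms(4) sum.reindex[OF assms(3)] comp_def ..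
    finally have lim: "integral\<^sup>L (dirac_sum (curve_topology X) {1..g} (\<lambda>_. 1 / real g) p) f =
        (\<Sum>x | node X x. f x) / real g" .
    define d where "d = real_of_int (sheaf_degree X L)"
    have d: "0 < d"
      using assms(6) by (simp add: d_def)
    \<comment> \<open>The estimate holds from some \<open>m\<close> on; the degree is a positive
      integer, so \<open>2 * g + 1 \<le> m\<close> suffices.\<close>
    have large: "\<forall>\<^sub>F m in sequentially. int m * sheaf_degree X L \<ge> 2 * int g + 1"
      unfolding eventually_sequentially
    proof (intro exI allI impI)
      fix m
      assume "2 * g + 1 \<le> m"
      moreover have "int m * 1 \<le> int m * sheaf_degree X L"
        using assms(6) by (intro mult_left_mono) auto
      ultimately show "int m * sheaf_degree X L \<ge> 2 * int g + 1"
        by linarith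
    qed
    \<comment> \<open>\<open>B\<close> depends on \<open>f\<close> but not on \<open>m\<close>, so
      the error decays like 1 / m.\<close>
    have "(\<lambda>m. 4 * B / (real m * d - 2 * real g)) \<longlonglongrightarrow> 0"
      using d by real_asymp
    then have "(\<lambda>m. integral\<^sup>L (weierstrass_measure X (tensor_power X m L)) f
        - (\<Sum>x | node X x. f x) / real g) \<longlonglongrightarrow> 0"
    proof (rule Lim_null_comparison[rotated])
      show "\<forall>\<^sub>F m in sequentially. norm (integral\<^sup>L (weierstrass_measure X (tensor_power X m L)) f
          - (\<Sum>x | node X x. f x) / real g) \<le> 4 * B / (real m * d - 2 * real g)"
        using large
      proof eventually_elim
        case (elim m)
        show ?case
          using weierstrass_measure_estimate[OF X assms(5,6) card elim f B(2)] by (simp add: d_def)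
      qed
    qed
    then show "(\<lambda>m. integral\<^sup>L (weierstrass_measure X (tensor_power X m L)) f)
        \<longlonglongrightarrow> integral\<^sup>L (dirac_sum (curve_topology X) {1..g} (\<lambda>_. 1 / real g) p) f"
      unfolding lim by (simp add: LIM_zero_iff)
  qed
qed


end
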